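(* Let $A,B$ be finite-dimensional Hilbert spaces, $d=\dim A$, and let $A'$ be isomorphic to $A\otimes A$. Consider the set of operators $$C_{A'B}^*:=\Big\{\sum_{x=1}^{d^2}P_{A'}^x\otimes\omega_B^x\;\Big|\;\forall x,x':\ P_{A'}^x\geq0,\ P_{A'}^xP_{A'}^{x'}=\delta_{xx'}P_{A'}^x,\ \omega_B^x\geq0\Big\}.$$ Let $\rho_{AB}>0$ be a quantum state and $\sigma_{AB}>0$ an operator, and let $\rho_{A'B}$ and $\sigma_{A'B}$ be consistent embeddings of $\rho_{AB}$ and $\sigma_{AB}$, respectively. Then $$D_{\mathsf{LOCC}_1(A\to B)}(\rho_{AB}\|\sigma_{AB})=\sup_{\substack{\omega_{A'B}>0\\ \omega_{A'B}\in C_{A'B}^*}}\Big\{\operatorname{tr}[\rho_{A'B}\log\omega_{A'B}]-\log\operatorname{tr}[\sigma_{A'B}\omega_{A'B}]\Big\}.$$ Moreover, the optimal measurement in the definition of $D_{\mathsf{LOCC}_1(A\to B)}(\rho_{AB}\|\sigma_{AB})$ can be taken to consist of a rank-$1$ POVM on $A$ with at most $d^2$ outcomes, followed by a projective measurement on $B$ conditional on the outcome on $A$.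
   Context: Quantum states are positive semidefinite operators of unit trace; $X>0$ means positive semidefinite with full support; $\log$ is the natural logarithm. Consistent embeddings means that there is an isometry $V:A\to A'$ with $\rho_{A'B}=(V\otimes1_B)\rho_{AB}(V\otimes1_B)^\dagger$ and $\sigma_{A'B}=(V\otimes1_B)\sigma_{AB}(V\otimes1_B)^\dagger$ (the same $V$ for both). A POVM is a finite family $M=\{M^z\}_z$ of positive semidefinite operators with $\sum_zM^z=1$; it is rank-1 if all its elements are of rank one. $\mathsf{LOCC}_1(A\to B)$ is the set of POVMs on $A\otimes B$ of the form $M^z_{AB}=\sum_x Q_A^x\otimes Q_B^{z|x}$ with $Q_A^x,Q_B^{z|x}\geq0$, $\sum_xQ_A^x=1_A$ and $\sum_zQ_B^{z|x}=1_B$ for every $x$ (measure $A$ first, send outcome $x$, then measure $B$ depending on $x$). The measured relative entropy is $D_{\mathsf{LOCC}_1(A\to B)}(\rho\|\sigma)=\sup_{M\in\mathsf{LOCC}_1(A\to B)}D(\mathbb P_{\rho,M}\|\mathbb P_{\sigma,M})$, where $\mathbb P_{\rho,M}(z)=\operatorname{tr}[\rho M^z]$ and $D(P\|Q)=\sum_zP(z)\log\frac{P(z)}{Q(z)}$. *)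

theory Defs
  imports "HOL-Analysis.Analysis"
begin

text \<open>
  A Hilbert space of dimension \<open>n\<close> is \<open>complex ^ 'n\<close> with \<open>CARD('n) = n\<close>, operators are square
  matrices, and the tensor product of \<open>complex ^ 'a\<close> and \<open>complex ^ 'b\<close> is \<open>complex ^ ('a \<times> 'b)\<close>.
\<close>

definition hinner :: "complex ^ 'n \<Rightarrow> complex ^ 'n \<Rightarrow> complex" where
  "hinner x y = (\<Sum>i\<in>UNIV. cnj (x $ i) * y $ i)"

definition dagger :: "complex ^ 'n ^ 'm \<Rightarrow> complex ^ 'm ^ 'n" where
  "dagger A = (\<chi> i j. cnj (A $ j $ i))"

definition psd :: "complex ^ 'n ^ 'n \<Rightarrow> bool" where
  "psd X \<longleftrightarrow> (\<forall>v. hinner v (X *v v) \<in> \<real>\<^sub>\<ge>\<^sub>0)"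

text \<open>Full support means trivial kernel.\<close>

definition pos_full :: "complex ^ 'n ^ 'n \<Rightarrow> bool" where
  "pos_full X \<longleftrightarrow> psd X \<and> (\<forall>v. X *v v = 0 \<longrightarrow> v = 0)"

definition quantum_state :: "complex ^ 'n ^ 'n \<Rightarrow> bool" where
  "quantum_state \<rho> \<longleftrightarrow> psd \<rho> \<and> trace \<rho> = 1"

definition isometry :: "complex ^ 'n ^ 'm \<Rightarrow> bool" where
  "isometry V \<longleftrightarrow> dagger V ** V = mat 1"

definition kron ::
    "complex ^ 'a ^ 'c \<Rightarrow> complex ^ 'b ^ 'e \<Rightarrow> complex ^ ('a \<times> 'b) ^ ('c \<times> 'e)"
    (infixr \<open>\<otimes>\<^sub>K\<close> 75) where
  "A \<otimes>\<^sub>K B = (\<chi> i j. A $ fst i $ fst j * B $ snd i $ snd j)"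

definition real_diag :: "('n \<Rightarrow> real) \<Rightarrow> complex ^ 'n ^ 'n" where
  "real_diag l = (\<chi> i j. if i = j then complex_of_real (l i) else 0)"

text \<open>
  Functional calculus for Hermitian matrices. The result does not depend on the chosen unitary
  diagonalization (\<open>spectral_fun_eqI\<close> below); for non-Hermitian \<open>X\<close> the value is unspecified.
\<close>

definition spectral_fun :: "(real \<Rightarrow> real) \<Rightarrow> complex ^ 'n ^ 'n \<Rightarrow> complex ^ 'n ^ 'n" where
  "spectral_fun f X = (THE Y. \<exists>(U :: complex ^ 'n ^ 'n) l. dagger U ** U = mat 1 \<and> X = U ** real_diag l ** dagger U
     \<and> Y = U ** real_diag (\<lambda>i. f (l i)) ** dagger U)"

definition op_log :: "complex ^ 'n ^ 'n \<Rightarrow> complex ^ 'n ^ 'n" where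
  "op_log X = spectral_fun ln X"

lemma spectral_fun_eqI:
  fixes U :: "complex ^ 'n ^ 'n"
  assumes U: "dagger U ** U = mat 1"
  shows "spectral_fun f (U ** real_diag l ** dagger U) = U ** real_diag (\<lambda>i. f (l i)) ** dagger U"
  unfolding spectral_fun_def
proof (rule the_equality)
  show "\<exists>(U' :: complex ^ 'n ^ 'n) l'. dagger U' ** U' = mat 1 \<and>
      U ** real_diag l ** dagger U = U' ** real_diag l' ** dagger U' \<and>
      U ** real_diag (\<lambda>i. f (l i)) ** dagger U = U' ** real_diag (\<lambda>i. f (l' i)) ** dagger U'"
    using U by blast
next
  fix Y
  assume "\<exists>(U' :: complex ^ 'n ^ 'n) l'. dagger U' ** U' = mat 1 \<and>
      U ** real_diag l ** dagger U = U' ** real_diag l' ** dagger U' \<and>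
      Y = U' ** real_diag (\<lambda>i. f (l' i)) ** dagger U'"
  then obtain W :: "complex ^ 'n ^ 'n" and m where W: "dagger W ** W = mat 1"
    and eq: "U ** real_diag l ** dagger U = W ** real_diag m ** dagger W"
    and Y: "Y = W ** real_diag (\<lambda>i. f (m i)) ** dagger W" by blast
  have W': "W ** dagger W = mat 1" and U': "U ** dagger U = mat 1"
    using W U matrix_left_right_inverse by blast+
  define T where "T = dagger W ** U"
  have diagR: "(T ** real_diag g) $ i $ j = T $ i $ j * of_real (g j)" for g i j
    by (simp add: matrix_matrix_mult_def real_diag_def if_distrib cong: if_cong)
  have diagL: "(real_diag g ** T) $ i $ j = of_real (g i) * T $ i $ j" for g i j
    by (simp add: matrix_matrix_mult_def real_diag_def if_distrib if_distribR cong: if_cong)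
  have "T ** real_diag l = dagger W ** (U ** real_diag l ** dagger U) ** U"
    unfolding T_def by (metis U matrix_mul_assoc matrix_mul_rid)
  also have "\<dots> = real_diag m ** T"
    unfolding T_def eq by (metis W matrix_mul_assoc matrix_mul_lid)
  finally have *: "T $ i $ j * of_real (l j) = of_real (m i) * T $ i $ j" for i j
    by (metis diagL diagR)
  have "T ** real_diag (\<lambda>i. f (l i)) = real_diag (\<lambda>i. f (m i)) ** T"
  proof -
    have "T $ i $ j * of_real (f (l j)) = of_real (f (m i)) * T $ i $ j" for i j
      using *[of i j] by (cases "T $ i $ j = 0") auto
    then show ?thesis by (simp add: vec_eq_iff diagL diagR)
  qed
  then have "W ** (T ** real_diag (\<lambda>i. f (l i))) ** dagger U
      = W ** (real_diag (\<lambda>i. f (m i)) ** T) ** dagger U" by simp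
  then show "Y = U ** real_diag (\<lambda>i. f (l i)) ** dagger U"
    unfolding Y T_def by (metis U' W' matrix_mul_assoc matrix_mul_lid matrix_mul_rid)
qed

definition povm :: "'z set \<Rightarrow> ('z \<Rightarrow> complex ^ 'n ^ 'n) \<Rightarrow> bool" where
  "povm Z M \<longleftrightarrow> finite Z \<and> (\<forall>z\<in>Z. psd (M z)) \<and> (\<Sum>z\<in>Z. M z) = mat 1"

definition rank1_povm :: "'z set \<Rightarrow> ('z \<Rightarrow> complex ^ 'n ^ 'n) \<Rightarrow> bool" where
  "rank1_povm Z M \<longleftrightarrow> povm Z M \<and> (\<forall>z\<in>Z. rank (M z) = 1)"

definition projective_measurement :: "'z set \<Rightarrow> ('z \<Rightarrow> complex ^ 'n ^ 'n) \<Rightarrow> bool" where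
  "projective_measurement Z M \<longleftrightarrow> povm Z M \<and>
     (\<forall>z\<in>Z. \<forall>z'\<in>Z. M z ** M z' = (if z = z' then M z else 0))"

definition one_way ::
    "'x set \<Rightarrow> ('x \<Rightarrow> complex ^ 'a ^ 'a) \<Rightarrow> ('x \<Rightarrow> 'z \<Rightarrow> complex ^ 'b ^ 'b)
      \<Rightarrow> 'z \<Rightarrow> complex ^ ('a \<times> 'b) ^ ('a \<times> 'b)" where
  "one_way X QA QB z = (\<Sum>x\<in>X. QA x \<otimes>\<^sub>K QB x z)"

text \<open>
  Measurements are pairs of an outcome set and a family. Outcomes are labelled by natural numbers,
  which covers all finite families up to relabelling.
\<close>

definition LOCC1 ::
    "(nat set \<times> (nat \<Rightarrow> complex ^ ('a::finite \<times> 'b::finite) ^ ('a \<times> 'b))) set" where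
  "LOCC1 = {(Z, M). povm Z M \<and>
     (\<exists>(X :: nat set) QA QB. povm X QA \<and> (\<forall>x\<in>X. povm Z (QB x)) \<and>
        (\<forall>z\<in>Z. M z = one_way X QA QB z))}"

definition outcome_dist ::
    "complex ^ 'n ^ 'n \<Rightarrow> ('z \<Rightarrow> complex ^ 'n ^ 'n) \<Rightarrow> 'z \<Rightarrow> real" where
  "outcome_dist \<rho> M z = Re (trace (\<rho> ** M z))"

text \<open>
  With \<open>0 / 0 = 0\<close> the sum uses the usual convention that terms with \<open>P z = 0\<close> vanish.
\<close>

definition rel_entropy :: "'z set \<Rightarrow> ('z \<Rightarrow> real) \<Rightarrow> ('z \<Rightarrow> real) \<Rightarrow> ereal" where
  "rel_entropy Z P Q = (if \<exists>z\<in>Z. P z \<noteq> 0 \<and> Q z = 0 then \<infinity>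
     else ereal (\<Sum>z\<in>Z. P z * ln (P z / Q z)))"

definition D_LOCC1 ::
    "complex ^ ('a::finite \<times> 'b::finite) ^ ('a \<times> 'b)
      \<Rightarrow> complex ^ ('a \<times> 'b) ^ ('a \<times> 'b) \<Rightarrow> ereal" where
  "D_LOCC1 \<rho> \<sigma> = (SUP (Z, M)\<in>LOCC1. rel_entropy Z (outcome_dist \<rho> M) (outcome_dist \<sigma> M))"

text \<open>The parameter \<open>n\<close> is the number of summands, to be instantiated with \<open>(dim A)\<^sup>2\<close>.\<close>

definition C_star :: "nat \<Rightarrow> (complex ^ ('c::finite \<times> 'b::finite) ^ ('c \<times> 'b)) set" where
  "C_star n = {\<Sum>x = 1..n. P x \<otimes>\<^sub>K \<omega> x | P \<omega>.
     \<forall>x\<in>{1..n}. \<forall>x'\<in>{1..n}.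
       psd (P x) \<and> P x ** P x' = (if x = x' then P x else 0) \<and> psd (\<omega> x)}"

definition embed_A ::
    "complex ^ 'a ^ 'c \<Rightarrow> complex ^ ('a \<times> 'b::finite) ^ ('a \<times> 'b)
      \<Rightarrow> complex ^ ('c \<times> 'b) ^ ('c \<times> 'b)" where
  "embed_A V X = (V \<otimes>\<^sub>K mat 1) ** X ** dagger (V \<otimes>\<^sub>K mat 1)"

end

theory Submission
  imports Defs
begin

text \<open>
  Both sides equal the maximum \<open>m\<close> of \<open>\<Sum>\<^sub>x\<^sub>y t\<^sub>x p\<^sub>x\<^sub>y ln (p\<^sub>x\<^sub>y / q\<^sub>x\<^sub>y)\<close> over measurements of \<open>A\<close> by at most \<open>d\<^sup>2\<close>
  rank-one operators \<open>t\<^sub>x |n\<^sub>x\<rangle>\<langle>n\<^sub>x|\<close> followed by a basis measurement of \<open>B\<close> for each \<open>x\<close>; it is attained by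
  compactness. An arbitrary one-way measurement does not exceed \<open>m\<close>: keeping \<open>x\<close> and splitting
  \<open>Q\<^sup>x\<close> into rank-one terms only increases the relative entropy (log-sum inequality), given \<open>x\<close> a
  projective measurement of \<open>B\<close> is optimal (operator Jensen inequality for the logarithm), and a
  Caratheodory argument in the \<open>d\<^sup>2\<close>-dimensional real space of Hermitian matrices discards all but
  \<open>d\<^sup>2\<close> terms. An operator \<open>\<omega> = \<Sum>\<^sub>x P\<^sup>x \<otimes> \<omega>\<^sup>x\<close> induces the measurement \<open>V\<^sup>\<dagger> P\<^sup>x V\<close> followed by the eigenbasis of
  \<open>\<omega>\<^sup>x\<close>, whose relative entropy bounds the variational expression by Gibbs' inequality. Conversely,
  a Naimark dilation of the optimal rank-one measurement to \<open>A'\<close>, with eigenvalues \<open>p\<^sub>x\<^sub>y / q\<^sub>x\<^sub>y\<close>, attains \<open>m\<close>.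
\<close>

subsection \<open>Sesquilinear forms and matrices\<close>

text \<open>Since \<open>kl\<close> is homogeneous, the contribution of a rank-one outcome of weight
  \<open>t\<close> on A is linear in \<open>t\<close> once the basis measured on B is fixed. The
  bases are therefore optimized first and the weights afterwards, as a linear programme whose
  equality constraint lives in a real space of dimension \<open>d\<^sup>2\<close>. The same number
  is the dimension of A': a type \<open>'c\<close> of this size indexes the outcomes on A and also
  the orthonormal basis of A' to which they are dilated. Having one number of outcomes for every
  measurement to be bounded is what provides a single compact set, and so an optimal measurement
  instead of a mere supremum. Full support of \<rho> and \<sigma> makes the form of either strictly
  positive on nonzero product vectors. Hence the entropies are continuous, and the ratios p / q can
  serve as eigenvalues of an \<omega> of full support. They are the equality case of Gibbs'
  inequality and make the trace of \<sigma>' \<omega> equal to 1, so that the logarithmic correction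
  disappears.\<close>

lemma hinner_add_left: "hinner (x + y) z = hinner x z + hinner y z"
  and hinner_add_right: "hinner x (y + z) = hinner x y + hinner x z"
  and hinner_diff_left: "hinner (x - y) z = hinner x z - hinner y z"
  and hinner_diff_right: "hinner x (y - z) = hinner x y - hinner x z"
  and hinner_smult_left: "hinner (c *s x) y = cnj c * hinner x y"
  and hinner_smult_right: "hinner x (c *s y) = c * hinner x y"
  and hinner_scaleR_left: "hinner (r *\<^sub>R x) y = of_real r * hinner x y"
  and hinner_scaleR_right: "hinner x (r *\<^sub>R y) = of_real r * hinner x y"
  and hinner_zero_left [simp]: "hinner 0 y = 0"
  and hinner_zero_right [simp]: "hinner x 0 = 0"
  by (simp_all add: hinner_def algebra_simps sum.distrib sum_subtractf sum_distrib_left scaleR_conv_of_real[where 'a=complex])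

lemma hinner_sum_right: "hinner x (\<Sum>i\<in>I. f i) = (\<Sum>i\<in>I. hinner x (f i))"
  by (induction I rule: infinite_finite_induct) (auto simp: hinner_add_right)

lemma cnj_hinner: "cnj (hinner x y) = hinner y x"
  by (simp add: hinner_def mult.commute)

lemma hinner_self: "hinner x x = of_real ((norm x)\<^sup>2)"
proof -
  have "(norm x)\<^sup>2 = (\<Sum>i\<in>UNIV. (cmod (x $ i))\<^sup>2)"
    by (simp add: norm_vec_def L2_set_def sum_nonneg)
  then have "of_real ((norm x)\<^sup>2) = (\<Sum>i\<in>UNIV. (of_real (cmod (x $ i)))\<^sup>2 :: complex)"
    by simp
  also have "\<dots> = hinner x x"
    unfolding hinner_def by (intro sum.cong refl) (simp add: complex_norm_square mult.commute flip: of_real_power)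
  finally show ?thesis by simp
qed

lemma hinner_self_eq_0 [simp]: "hinner x x = 0 \<longleftrightarrow> x = 0"
  by (simp add: hinner_self)

lemma inner_eq_Re_hinner: "x \<bullet> y = Re (hinner x y)"
  by (simp add: inner_vec_def hinner_def inner_complex_def)

lemma hinner_matrix_left: "hinner x (A *v y) = hinner (dagger A *v x) y"
  unfolding hinner_def matrix_vector_mult_def dagger_def
  by (simp add: sum_distrib_left sum_distrib_right mult_ac) (rule sum.swap)

lemma dagger_dagger [simp]: "dagger (dagger A) = A"
  by (simp add: dagger_def vec_eq_iff)

lemma dagger_mult: "dagger (A ** B) = dagger B ** dagger A"
  by (simp add: dagger_def vec_eq_iff matrix_matrix_mult_def mult.commute)

lemma dagger_mat_1 [simp]: "dagger (mat 1) = mat 1"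
  by (auto simp: dagger_def vec_eq_iff mat_def)

lemma dagger_diff: "dagger (A - B) = dagger A - dagger B"
  by (simp add: dagger_def vec_eq_iff)

lemma dagger_scaleR: "dagger (r *\<^sub>R A) = r *\<^sub>R dagger A"
  by (simp add: dagger_def vec_eq_iff)

lemma hinner_matrix_right: "hinner (A *v x) y = hinner x (dagger A *v y)"
  by (simp add: hinner_matrix_left)

lemma matrix_add_rdistrib: "(A + B) ** C = A ** C + B ** (C :: complex ^ 'n ^ 'm)"
  by (simp add: matrix_matrix_mult_def vec_eq_iff distrib_right sum.distrib)

lemma matrix_sum_left: "(\<Sum>i\<in>I. f i) ** A = (\<Sum>i\<in>I. f i ** (A :: complex ^ 'n ^ 'm))"
  by (induction I rule: infinite_finite_induct)
    (auto simp: matrix_add_rdistrib)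

lemma matrix_sum_right: "(A :: complex ^ 'n ^ 'm) ** (\<Sum>i\<in>I. f i) = (\<Sum>i\<in>I. A ** f i)"
  by (induction I rule: infinite_finite_induct)
    (auto simp: matrix_add_ldistrib)

lemma matrix_sum_vec: "(\<Sum>i\<in>I. f i) *v v = (\<Sum>i\<in>I. f i *v (v :: complex ^ 'n))"
  by (induction I rule: infinite_finite_induct)
    (auto simp: matrix_vector_mult_add_rdistrib)

lemma matrix_scaleR_right: "(A :: complex ^ 'k ^ 'l) ** (r *\<^sub>R C) = r *\<^sub>R (A ** C)"
  by (simp add: matrix_matrix_mult_def vec_eq_iff scaleR_sum_right)

lemma scaleR_matrix_vec: "(r *\<^sub>R A) *v x = r *\<^sub>R ((A :: complex ^ 'n ^ 'm) *v x)"
  and matrix_vec_scaleR: "(A :: complex ^ 'n ^ 'm) *v (r *\<^sub>R x) = r *\<^sub>R (A *v x)"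
  by (simp_all add: matrix_vector_mult_def vec_eq_iff scaleR_sum_right)

lemma matrix_vec_smult: "(A :: complex ^ 'n ^ 'm) *v (c *s x) = c *s (A *v x)"
  by (simp add: matrix_vector_mult_def vec_eq_iff sum_distrib_left mult_ac)

lemma trace_sum: "trace (\<Sum>i\<in>I. f i :: complex ^ 'n ^ 'n) = (\<Sum>i\<in>I. trace (f i))"
  unfolding trace_def by (simp add: sum.swap[of _ I])

lemma trace_scaleR: "trace (r *\<^sub>R A :: complex ^ 'n ^ 'n) = of_real r * trace A"
  by (simp add: trace_def sum_distrib_left scaleR_conv_of_real[where 'a=complex])

section \<open>Rank-one operators and quadratic forms\<close>

definition ketbra :: "complex ^ 'n \<Rightarrow> complex ^ 'n ^ 'n" where
  "ketbra v = (\<chi> i j. v $ i * cnj (v $ j))"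

lemma ketbra_vec: "ketbra v *v x = hinner v x *s v"
  by (simp add: ketbra_def hinner_def vec_eq_iff matrix_vector_mult_def sum_distrib_left
      sum_distrib_right mult_ac)

lemma trace_ketbra: "trace (X ** ketbra v) = hinner v (X *v v)"
  unfolding trace_def ketbra_def hinner_def matrix_vector_mult_def matrix_matrix_mult_def
  by (simp add: sum_distrib_left mult_ac)

lemma trace_ketbra_1: "trace (ketbra v) = of_real ((norm v)\<^sup>2)"
  using trace_ketbra[of "mat 1" v] by (simp add: hinner_self)

lemma ketbra_mult: "ketbra u ** ketbra v = (\<chi> i j. hinner u v * u $ i * cnj (v $ j))"
  by (simp add: ketbra_def hinner_def vec_eq_iff matrix_matrix_mult_def sum_distrib_left
      sum_distrib_right mult_ac)

lemma ketbra_conj: "A ** ketbra v ** dagger A = ketbra (A *v v)"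
  unfolding matrix_eq
  by (simp add: ketbra_vec matrix_vec_smult hinner_matrix_left flip: matrix_vector_mul_assoc)

lemma ketbra_0 [simp]: "ketbra 0 = 0"
  by (simp add: ketbra_def vec_eq_iff)

lemma ketbra_scaleR: "ketbra (r *\<^sub>R v) = (r\<^sup>2) *\<^sub>R ketbra v"
  by (simp add: ketbra_def vec_eq_iff power2_eq_square)

lemma ketbra_mult_orthogonal: "hinner u v = 0 \<Longrightarrow> ketbra u ** ketbra v = 0"
  by (simp add: ketbra_mult vec_eq_iff)

lemma ketbra_mult_self: "hinner u u = 1 \<Longrightarrow> ketbra u ** ketbra u = ketbra u"
  by (simp add: ketbra_mult) (simp add: ketbra_def)

text \<open>The real part makes inequalities expressible for an arbitrary matrix; on positive
  semidefinite matrices nothing is lost, by \<open>psd_hinner\<close>.\<close>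

definition qform :: "complex ^ 'n ^ 'n \<Rightarrow> complex ^ 'n \<Rightarrow> real" where
  "qform X v = Re (hinner v (X *v v))"

lemma qform_eq_trace: "qform X v = Re (trace (X ** ketbra v))"
  by (simp add: qform_def trace_ketbra)

lemma qform_sum: "qform (\<Sum>i\<in>I. f i) v = (\<Sum>i\<in>I. qform (f i) v)"
  by (simp add: qform_def matrix_sum_vec hinner_sum_right)

lemma qform_scaleR: "qform (r *\<^sub>R A) v = r * qform A v"
  by (simp add: qform_def scaleR_matrix_vec hinner_scaleR_right)

lemma qform_scaleR_vec: "qform A (r *\<^sub>R v) = r\<^sup>2 * qform A v"
  by (simp add: qform_def matrix_vec_scaleR hinner_scaleR_right hinner_scaleR_left power2_eq_square)

lemma qform_mat_1: "qform (mat 1) v = (norm v)\<^sup>2"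
  by (simp add: qform_def hinner_self)

lemma qform_ketbra: "qform (ketbra u) v = (cmod (hinner u v))\<^sup>2"
proof -
  have "hinner v (ketbra u *v v) = hinner u v * cnj (hinner u v)"
    by (simp add: ketbra_vec hinner_smult_right cnj_hinner)
  then show ?thesis
    by (simp add: qform_def flip: complex_norm_square of_real_power)
qed

lemma qform_conj: "qform (dagger A ** X ** A) v = qform X (A *v v)"
  by (simp add: qform_def hinner_matrix_right matrix_vector_mul_assoc matrix_mul_assoc)

subsection \<open>Positive semidefinite matrices\<close>

lemma psd_hinner: "psd X \<Longrightarrow> hinner v (X *v v) = of_real (qform X v)"
  unfolding psd_def qform_def using nonneg_Reals_subset_Reals by (metis of_real_Re subsetD)

lemma psd_qform_nonneg: "psd X \<Longrightarrow> 0 \<le> qform X v"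
  unfolding psd_def qform_def by (metis complex_nonneg_Reals_iff)

text \<open>Over the complex numbers a matrix with vanishing quadratic form is zero, by
  polarization. Reality of the form of \<open>X\<close> says that this applies to
  \<open>X - dagger X\<close>.\<close>

lemma psd_imp_hermitian:
  assumes "psd X"
  shows "dagger X = X"
proof -
  define Y where "Y = X - dagger X"
  have form: "hinner v (Y *v v) = 0" for v
  proof -
    have "hinner v (dagger X *v v) = cnj (hinner v (X *v v))"
      by (simp add: hinner_matrix_left cnj_hinner)
    then show ?thesis
      using psd_hinner[OF assms, of v]
      by (simp add: Y_def matrix_vector_mult_diff_rdistrib hinner_diff_right)
  qed
  have polar: "hinner x (Y *v y) = 0" for x y
  proof -
    have sum: "hinner x (Y *v y) + hinner y (Y *v x) = 0" for x y
      using form[of "x + y"] form[of x] form[of y]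
      by (simp add: matrix_vector_right_distrib hinner_add_left hinner_add_right add.commute)
    \<comment> \<open>Replacing \<open>x\<close> by \<open>\<i> *s x\<close> turns the sum of the
      two cross terms into a multiple of their difference, so each of them vanishes.\<close>
    from sum[of "\<i> *s x" y] sum[of x y] show ?thesis
      by (simp add: matrix_vec_smult hinner_smult_left hinner_smult_right)
  qed
  have "Y *v y = 0" for y
    using polar[of "Y *v y" y] by simp
  then have "Y = 0"
    by (simp add: matrix_eq)
  then show ?thesis by (simp add: Y_def)
qed

lemma psdI:
  assumes "dagger X = X" and "\<And>v. 0 \<le> qform X v"
  shows "psd X"
proof -
  have "Im (hinner v (X *v v)) = 0" for v
  proof -
    have "cnj (hinner v (X *v v)) = hinner v (X *v v)"
      by (simp add: cnj_hinner hinner_matrix_left assms(1))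
    then show ?thesis by (metis Im_complex_of_real complex_is_Real_iff Reals_cnj_iff)
  qed
  with assms(2) show ?thesis
    by (simp add: psd_def qform_def complex_nonneg_Reals_iff)
qed

lemma dagger_ketbra [simp]: "dagger (ketbra v) = ketbra v"
  by (simp add: dagger_def ketbra_def vec_eq_iff)

lemma psd_ketbra: "psd (ketbra v)"
  by (rule psdI) (simp_all add: qform_ketbra)

lemma psd_0: "psd 0"
  using psd_ketbra[of 0] by simp

lemma psd_add: "psd A \<Longrightarrow> psd B \<Longrightarrow> psd (A + B)"
  by (auto simp: psd_def matrix_vector_mult_add_rdistrib hinner_add_right
      intro: nonneg_Reals_add_I)

lemma psd_sum: "(\<And>i. i \<in> I \<Longrightarrow> psd (f i)) \<Longrightarrow> psd (\<Sum>i\<in>I. f i)"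
  by (induction I rule: infinite_finite_induct) (auto simp: psd_0 psd_add)

lemma psd_scaleR: "0 \<le> r \<Longrightarrow> psd A \<Longrightarrow> psd (r *\<^sub>R A)"
  by (auto simp: psd_def scaleR_matrix_vec hinner_scaleR_right intro: nonneg_Reals_mult_I)

lemma psd_conj: "psd X \<Longrightarrow> psd (dagger A ** X ** A)"
  using psd_imp_hermitian[of X] psd_qform_nonneg[of X]
  by (intro psdI) (simp_all add: qform_conj dagger_mult matrix_mul_assoc)

lemma psd_mat_1: "psd (mat 1)"
  by (rule psdI) (simp_all add: qform_mat_1)

text \<open>For small positive \<open>s\<close> the linear term dominates. This is the first-order
  condition at a zero minimum of a quadratic form, with \<open>n\<close> the squared norm of the
  gradient direction.\<close>

lemma quadratic_nonneg_imp_0: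
  fixes n b :: real
  assumes nonneg: "\<And>s. 0 \<le> - 2 * s * n + s\<^sup>2 * b" and "0 \<le> n" "0 \<le> b"
  shows "n = 0"
proof (rule ccontr)
  assume "n \<noteq> 0"
  \<comment> \<open>The denominator \<open>b + 1\<close> is positive even for \<open>b = 0\<close>
    and gives \<open>s * b \<le> n\<close>, too little to compensate \<open>2 * n\<close>.\<close>
  define s where "s = n / (b + 1)"
  have s: "s * (b + 1) = n" "0 < s"
    using assms \<open>n \<noteq> 0\<close> by (auto simp: s_def)
  have "0 \<le> s * (- 2 * n + s * b)"
    using nonneg[of s] by (simp add: algebra_simps power2_eq_square)
  then have "2 * n \<le> s * b" using s by (simp add: zero_le_mult_iff)
  also have "\<dots> \<le> n" using s by (simp add: algebra_simps)
  finally show False using \<open>n \<noteq> 0\<close> \<open>0 \<le> n\<close> by simp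
qed

text \<open>A zero of a nonnegative form is a minimum; a move from \<open>v\<close> along
  \<open>- X *v v\<close> would make the form negative unless \<open>X *v v = 0\<close>, which full
  support excludes.\<close>

lemma pos_full_qform_pos:
  assumes "pos_full X" and "v \<noteq> 0"
  shows "0 < qform X v"
proof -
  have X: "psd X" using assms by (simp add: pos_full_def)
  note H = psd_imp_hermitian[OF X]
  have "qform X v \<noteq> 0"
  proof
    assume 0: "qform X v = 0"
    define z where "z = X *v v"
    define b where "b = qform X z"
    have b: "0 \<le> b" using psd_qform_nonneg[OF X] by (simp add: b_def)
    have "0 \<le> - 2 * s * (norm z)\<^sup>2 + s\<^sup>2 * b" for s
    proof -
      have zz: "hinner v (X *v z) = of_real ((norm z)\<^sup>2)" "hinner z (X *v v) = of_real ((norm z)\<^sup>2)"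
        by (simp_all add: hinner_matrix_left H z_def hinner_self flip: z_def)
      have "0 \<le> qform X (v - s *\<^sub>R z)"
        using psd_qform_nonneg[OF X] .
      also have "\<dots> = - 2 * s * (norm z)\<^sup>2 + s\<^sup>2 * b"
        using 0 by (simp add: qform_def b_def matrix_vector_mult_diff_distrib hinner_diff_left
            hinner_diff_right matrix_vec_scaleR hinner_scaleR_left hinner_scaleR_right zz
            power2_eq_square algebra_simps)
      finally show ?thesis .
    qed
    then have "z = 0"
      using quadratic_nonneg_imp_0[of "(norm z)\<^sup>2" b] b by simp
    then show False using assms by (simp add: pos_full_def z_def)
  qed
  with psd_qform_nonneg[OF X, of v] show ?thesis by simp
qed

lemma qform_pos_imp_pos_full:
  assumes "psd X" and "\<And>v. v \<noteq> 0 \<Longrightarrow> 0 < qform X v"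
  shows "pos_full X"
  using assms unfolding pos_full_def qform_def by fastforce

subsection \<open>Orthonormal bases and the spectral theorem\<close>

definition orthonormal :: "(complex ^ 'n) set \<Rightarrow> bool" where
  "orthonormal E \<longleftrightarrow> (\<forall>x\<in>E. \<forall>y\<in>E. hinner x y = (if x = y then 1 else 0))"

text \<open>The real dimension is twice the complex one, but only some uniform bound on the
  cardinality matters here; the exact count comes later from a trace.\<close>

lemma orthonormal_bound:
  assumes "orthonormal (E :: (complex ^ 'n) set)"
  shows "finite E" "card E \<le> DIM(complex ^ 'n)"
proof -
  have "pairwise orthogonal E"
    using assms by (auto simp: pairwise_def orthogonal_def inner_eq_Re_hinner orthonormal_def)
  moreover have "0 \<notin> E"
    using assms unfolding orthonormal_def by (metis hinner_zero_left zero_neq_one)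
  ultimately have "independent E"
    by (rule pairwise_orthogonal_independent)
  then show "finite E" "card E \<le> DIM(complex ^ 'n)"
    using independent_bound[of E] by auto
qed

lemma orthonormal_insert:
  assumes "orthonormal E" "norm v = 1" "\<forall>e\<in>E. hinner e v = 0"
  shows "orthonormal (insert v E)" "v \<notin> E"
proof -
  have v: "hinner v v = 1" using assms by (simp add: hinner_self)
  have "hinner v e = 0" if "e \<in> E" for e
    using assms(3) that cnj_hinner[of e v] by simp
  then show "orthonormal (insert v E)" "v \<notin> E"
    using assms v by (auto simp: orthonormal_def)
qed

text \<open>An orthonormal family of maximal cardinality inside \<open>K\<close> is complete, since
  otherwise \<open>ext\<close> enlarges it. The set \<open>K\<close> lets one argument serve twice:
  all vectors when an isometry is extended, the eigenvectors of \<open>H\<close> in the spectral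
  theorem.\<close>

lemma extend_to_complete_orthonormal:
  assumes "orthonormal E0" and "E0 \<subseteq> K"
    and ext: "\<And>E w. \<lbrakk>orthonormal E; E \<subseteq> K; w \<noteq> 0; \<forall>e\<in>E. hinner e w = 0\<rbrakk>
      \<Longrightarrow> \<exists>v\<in>K. norm v = 1 \<and> (\<forall>e\<in>E. hinner e v = 0)"
  obtains E :: "(complex ^ 'n) set" where "orthonormal E" "E0 \<subseteq> E" "E \<subseteq> K"
    "\<And>w. \<forall>e\<in>E. hinner e w = 0 \<Longrightarrow> w = 0"
proof -
  let ?P = "\<lambda>E. orthonormal E \<and> E0 \<subseteq> E \<and> E \<subseteq> K"
  have "?P E0" using assms by simp
  moreover have "\<forall>E. ?P E \<longrightarrow> card E < Suc (DIM(complex ^ 'n))"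
    using orthonormal_bound(2) less_Suc_eq_le by blast
  ultimately obtain E where E: "?P E" and max: "\<And>F. ?P F \<Longrightarrow> card F \<le> card E"
    using ex_has_greatest_nat[of ?P E0 card "Suc (DIM(complex ^ 'n))"] by metis
  have "w = 0" if w: "\<forall>e\<in>E. hinner e w = 0" for w
  proof (rule ccontr)
    assume "w \<noteq> 0"
    with E w ext obtain v where v: "v \<in> K" "norm v = 1" "\<forall>e\<in>E. hinner e v = 0"
      by blast
    have "?P (insert v E)" and "v \<notin> E"
      using orthonormal_insert[of E v] E v by auto
    with max[of "insert v E"] orthonormal_bound(1)[of E] E show False by simp
  qed
  with E that show ?thesis by blast
qed

lemma complete_orthonormal_resolution:
  fixes E :: "(complex ^ 'n) set"
  assumes "orthonormal E" and complete: "\<And>w. \<forall>e\<in>E. hinner e w = 0 \<Longrightarrow> w = 0"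
  shows "(\<Sum>e\<in>E. ketbra e) = mat 1" and "card E = CARD('n)"
proof -
  have fin: "finite E" using orthonormal_bound assms by blast
  have "(\<Sum>e\<in>E. ketbra e) *v v = v" for v
  proof -
    define w where "w = v - (\<Sum>e\<in>E. hinner e v *s e)"
    have "hinner e w = 0" if "e \<in> E" for e
    proof -
      have "hinner e (\<Sum>f\<in>E. hinner f v *s f) = (\<Sum>f\<in>E. if f = e then hinner e v else 0)"
        unfolding hinner_sum_right
        using assms(1) that by (intro sum.cong refl) (auto simp: hinner_smult_right orthonormal_def)
      then show ?thesis using that fin by (simp add: w_def hinner_diff_right)
    qed
    then have "w = 0" using complete by blast
    then show ?thesis by (simp add: w_def matrix_sum_vec ketbra_vec)
  qed
  then show *: "(\<Sum>e\<in>E. ketbra e) = mat 1" by (simp add: matrix_eq)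
  have "trace (\<Sum>e\<in>E. ketbra e) = of_nat (card E)"
  proof -
    have "trace (ketbra e) = 1" if "e \<in> E" for e
      using assms(1) that trace_ketbra[of "mat 1" e] by (simp add: orthonormal_def)
    then show ?thesis by (simp add: trace_sum)
  qed
  then show "card E = CARD('n)"
    unfolding * trace_I by (simp only: of_nat_eq_iff)
qed

section \<open>Unitaries and completion of isometries\<close>

abbreviation unitary :: "complex ^ 'n ^ 'n \<Rightarrow> bool" where
  "unitary U \<equiv> dagger U ** U = mat 1"

lemma unitary_right: "unitary U \<Longrightarrow> U ** dagger U = mat 1"
  using matrix_left_right_inverse by blast

lemma dagger_mult_self_nth: "(dagger U ** V) $ i $ j = hinner (column i U) (column j V)"
  by (simp add: dagger_def matrix_matrix_mult_def hinner_def column_def)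

lemma isometry_iff_columns:
  "dagger V ** V = mat 1 \<longleftrightarrow>
    (\<forall>i j. hinner (column i V) (column j V) = (if i = j then 1 else 0))"
  by (simp add: vec_eq_iff dagger_mult_self_nth) (simp add: mat_def)

lemma column_chi: "column j (\<chi> i j. f j $ i) = f j"
  by (simp add: column_def vec_eq_iff)

lemma sum_ketbra_column: "(\<Sum>j\<in>UNIV. l j *\<^sub>R ketbra (column j U)) = U ** real_diag l ** dagger U"
  by (simp add: vec_eq_iff matrix_matrix_mult_def real_diag_def dagger_def ketbra_def column_def
      if_distrib scaleR_conv_of_real[where 'a = complex] mult_ac cong: if_cong)

lemma unitary_resolution: "unitary U \<Longrightarrow> (\<Sum>j\<in>UNIV. ketbra (column j U)) = mat 1"
proof -
  assume "unitary U"
  moreover have "real_diag (\<lambda>_. 1) = (mat 1 :: complex ^ 'a ^ 'a)"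
    by (simp add: real_diag_def mat_def vec_eq_iff)
  ultimately show ?thesis
    using sum_ketbra_column[of "\<lambda>_. 1" U] unitary_right by simp
qed

text \<open>The map \<open>f\<close> only selects the columns of the unitary that carry those of
  \<open>V\<close>. The other positions and the remaining basis vectors are equally many and are
  matched by an arbitrary bijection \<open>g\<close>.\<close>

lemma isometry_extension:
  fixes V :: "complex ^ 'a ^ 'c" and f :: "'a \<Rightarrow> 'c"
  assumes V: "dagger V ** V = mat 1" and "inj f"
  obtains U where "unitary U" "\<And>a. column (f a) U = column a V"
proof -
  define E0 where "E0 = range (\<lambda>a. column a V)"
  have cols: "hinner (column i V) (column j V) = (if i = j then 1 else 0)" for i j
    using V by (simp add: isometry_iff_columns)
  have inj: "inj (\<lambda>a. column a V)"
    by (rule injI) (metis cols zero_neq_one)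
  have "orthonormal E0"
    unfolding orthonormal_def E0_def using cols inj by (auto dest: injD)
  then obtain E where E: "orthonormal E" "E0 \<subseteq> E" "\<And>w. \<forall>e\<in>E. hinner e w = 0 \<Longrightarrow> w = 0"
  proof (rule extend_to_complete_orthonormal[where K = UNIV])
    fix E and w :: "complex ^ 'c"
    assume "w \<noteq> 0" "\<forall>e\<in>E. hinner e w = 0"
    then show "\<exists>v\<in>UNIV. norm v = 1 \<and> (\<forall>e\<in>E. hinner e v = 0)"
      by (intro bexI[of _ "(1 / norm w) *\<^sub>R w"]) (auto simp: hinner_scaleR_right)
  qed auto
  have fin: "finite E" and card: "card E = CARD('c)"
    using complete_orthonormal_resolution[of E] E orthonormal_bound by auto
  have "card (E - E0) = card (UNIV - range f)"
    using fin card E(2) \<open>inj f\<close> inj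
    by (simp add: card_Diff_subset E0_def card_image finite_subset)
  then obtain g where g: "bij_betw g (UNIV - range f) (E - E0)"
    using fin by (metis finite_Diff finite bij_betw_iff_card)
  define b where "b = (\<lambda>k. if k \<in> range f then column (inv f k) V else g k)"
  have b_f: "b (f a) = column a V" for a
    using \<open>inj f\<close> by (simp add: b_def)
  have b_E: "b k \<in> E" for k
    using g E(2) by (auto simp: b_def E0_def bij_betw_def)
  have "inj b"
  proof (rule injI)
    fix k l assume eq: "b k = b l"
    have in0: "b k \<in> E0 \<longleftrightarrow> k \<in> range f" for k
      using g by (auto simp: b_def E0_def bij_betw_def)
    show "k = l"
    proof (cases "k \<in> range f")
      case True
      with in0 eq have "l \<in> range f" by metis
      with True eq inj show ?thesis by (auto simp: b_f dest: injD)
    next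
      case False
      with in0 eq have "l \<notin> range f" by metis
      with False eq g show ?thesis by (auto simp: b_def bij_betw_def inj_on_def)
    qed
  qed
  define U where "U = (\<chi> i k. b k $ i)"
  have "column k U = b k" for k by (simp add: U_def column_chi)
  with b_f b_E E(1) \<open>inj b\<close> that[of U] show ?thesis
    by (simp add: isometry_iff_columns orthonormal_def inj_eq)
qed

text \<open>Completed along the same injection, \<open>V = P ** F\<close> and
  \<open>W = Q ** F\<close> with one coordinate inclusion \<open>F\<close>, so
  \<open>Q ** dagger P\<close> takes \<open>V\<close> to \<open>W\<close>. It later transports a
  Naimark dilation to the prescribed embedding.\<close>

lemma isometry_unitary_equivalent:
  fixes V W :: "complex ^ 'a ^ 'c"
  assumes V: "dagger V ** V = mat 1" and W: "dagger W ** W = mat 1"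
    and card: "CARD('a) \<le> CARD('c)"
  obtains T where "unitary T" "T ** V = W"
proof -
  from card obtain f :: "'a \<Rightarrow> 'c" where f: "inj f"
    by (metis card_le_inj finite subset_UNIV inj_on_subset)
  obtain P where P: "unitary P" "\<And>a. column (f a) P = column a V"
    using isometry_extension[OF V f] by metis
  obtain Q where Q: "unitary Q" "\<And>a. column (f a) Q = column a W"
    using isometry_extension[OF W f] by metis
  define F :: "complex ^ 'a ^ 'c" where "F = (\<chi> k a. if k = f a then 1 else 0)"
  have F: "A ** F = B" if "\<And>a. column (f a) A = column a B" for A :: "complex ^ 'c ^ 'c" and B
    using that by (simp add: F_def matrix_matrix_mult_def vec_eq_iff column_def if_distrib cong: if_cong)
  have "Q ** dagger P ** V = Q ** dagger P ** (P ** F)"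
    using F[OF P(2)] by simp
  also have "\<dots> = Q ** F" using P(1) by (metis matrix_mul_assoc matrix_mul_lid)
  also have "\<dots> = W" using F[OF Q(2)] .
  finally have "Q ** dagger P ** V = W" .
  moreover have "unitary (Q ** dagger P)"
    using P(1) Q(1) unitary_right by (metis dagger_dagger dagger_mult matrix_mul_assoc matrix_mul_lid)
  ultimately show ?thesis using that by blast
qed

text \<open>The vector \<open>v\<close> maximizes the form of \<open>H\<close> on the unit sphere of
  the orthogonal complement of \<open>E\<close>. There \<open>K\<close>, the maximum minus
  \<open>H\<close>, has a nonnegative form that vanishes at \<open>v\<close>. As \<open>E\<close>
  consists of eigenvectors, \<open>K\<close> preserves the complement, so \<open>K *v v\<close> is
  an admissible direction and the first-order argument gives \<open>K *v v = 0\<close>.\<close>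

lemma hermitian_eigenvector_extension:
  fixes H :: "complex ^ 'n ^ 'n"
  assumes H: "dagger H = H"
    and eig: "\<And>e. e \<in> E \<Longrightarrow> \<exists>l :: real. H *v e = l *\<^sub>R e"
    and w: "w \<noteq> 0" "\<forall>e\<in>E. hinner e w = 0"
  obtains v and l :: real where "H *v v = l *\<^sub>R v" "norm v = 1" "\<forall>e\<in>E. hinner e v = 0"
proof -
  define S where "S = {v. norm v = 1 \<and> (\<forall>e\<in>E. hinner e v = 0)}"
  have cont: "continuous_on A (\<lambda>v. hinner (f v) (g v))"
    if "continuous_on A f" "continuous_on A g" for A f and g :: "complex ^ 'n \<Rightarrow> complex ^ 'n"
    unfolding hinner_def by (intro continuous_intros that)
  have "S = sphere 0 1 \<inter> (\<Inter>e\<in>E. {v. hinner e v = 0})"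
    by (auto simp: S_def)
  moreover have "closed {v. hinner e v = 0}" for e :: "complex ^ 'n"
    using cont[of UNIV "\<lambda>_. e" "\<lambda>v. v"] by (intro closed_Collect_eq) auto
  ultimately have "compact S"
    by (simp add: compact_Int_closed closed_INT)
  moreover have "S \<noteq> {}"
  proof -
    have "(1 / norm w) *\<^sub>R w \<in> S"
      using w by (simp add: S_def hinner_scaleR_right)
    then show ?thesis by blast
  qed
  moreover have "continuous_on S (qform H)"
    unfolding qform_def matrix_vector_mult_def
    by (intro continuous_intros cont)
  ultimately have "\<exists>v\<in>S. \<forall>u\<in>S. qform H u \<le> qform H v"
    by (rule continuous_attains_sup)
  then obtain v where v: "v \<in> S" and max: "\<And>u. u \<in> S \<Longrightarrow> qform H u \<le> qform H v"
    by blast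
  define l where "l = qform H v"
  define K where "K = l *\<^sub>R mat 1 - H"
  have K: "dagger K = K"
    by (simp add: K_def dagger_diff dagger_scaleR H)
  have qK: "qform K u = l * (norm u)\<^sup>2 - qform H u" for u
    by (simp add: K_def qform_def matrix_vector_mult_diff_rdistrib hinner_diff_right
        scaleR_matrix_vec hinner_scaleR_right hinner_self)
  have perp_K: "hinner e (K *v u) = 0" if u: "\<forall>e\<in>E. hinner e u = 0" and "e \<in> E" for e u
  proof -
    obtain m :: real where "H *v e = m *\<^sub>R e" using eig \<open>e \<in> E\<close> by blast
    then have "K *v e = (l - m) *\<^sub>R e"
      by (simp add: K_def matrix_vector_mult_diff_rdistrib scaleR_matrix_vec scaleR_left_diff_distrib)
    then show ?thesis using u \<open>e \<in> E\<close> by (simp add: hinner_matrix_left K hinner_scaleR_left)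
  qed
  have nonneg: "0 \<le> qform K u" if u: "\<forall>e\<in>E. hinner e u = 0" for u
  proof (cases "u = 0")
    case False
    then have "(1 / norm u) *\<^sub>R u \<in> S" using u by (simp add: S_def hinner_scaleR_right)
    from max[OF this] False show ?thesis
      by (simp add: qK l_def qform_scaleR_vec power_divide divide_le_eq mult.commute)
  qed (simp add: qform_def)
  define z where "z = K *v v"
  have v0: "qform K v = 0" "\<forall>e\<in>E. hinner e v = 0" "norm v = 1"
    using v by (auto simp: qK l_def S_def)
  have z: "\<forall>e\<in>E. hinner e z = 0" using perp_K v0 by (simp add: z_def)
  have "0 \<le> - 2 * s * (norm z)\<^sup>2 + s\<^sup>2 * qform K z" for s
  proof -
    have zz: "hinner v (K *v z) = of_real ((norm z)\<^sup>2)" "hinner z (K *v v) = of_real ((norm z)\<^sup>2)"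
      by (simp_all add: hinner_matrix_left K z_def hinner_self flip: z_def)
    have "0 \<le> qform K (v - s *\<^sub>R z)"
      using v0 z by (intro nonneg) (simp add: hinner_diff_right hinner_scaleR_right)
    also have "\<dots> = - 2 * s * (norm z)\<^sup>2 + s\<^sup>2 * qform K z"
      using v0(1) by (simp add: qform_def matrix_vector_mult_diff_distrib hinner_diff_left
          hinner_diff_right matrix_vec_scaleR hinner_scaleR_left hinner_scaleR_right zz
          power2_eq_square algebra_simps)
    finally show ?thesis .
  qed
  then have "(norm z)\<^sup>2 = 0"
    by (rule quadratic_nonneg_imp_0[OF _ zero_le_power2 nonneg[OF z]])
  then have "z = 0" by simp
  then have "H *v v = l *\<^sub>R v"
    by (simp add: z_def K_def matrix_vector_mult_diff_rdistrib scaleR_matrix_vec)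
  with v0 that show ?thesis by blast
qed

lemma spectral_theorem:
  fixes H :: "complex ^ 'n ^ 'n"
  assumes H: "dagger H = H"
  obtains U l where "unitary U" "H = (\<Sum>j\<in>UNIV. l j *\<^sub>R ketbra (column j U))"
proof -
  define K where "K = {v. \<exists>l :: real. H *v v = l *\<^sub>R v}"
  obtain E where E: "orthonormal E" "E \<subseteq> K" "\<And>w. \<forall>e\<in>E. hinner e w = 0 \<Longrightarrow> w = 0"
  proof (rule extend_to_complete_orthonormal[of "{}" K])
    fix E and w :: "complex ^ 'n"
    assume *: "E \<subseteq> K" "w \<noteq> 0" "\<forall>e\<in>E. hinner e w = 0"
    show "\<exists>v\<in>K. norm v = 1 \<and> (\<forall>e\<in>E. hinner e v = 0)"
    proof (rule hermitian_eigenvector_extension[OF H _ *(2,3)])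
      fix e assume "e \<in> E"
      then show "\<exists>l :: real. H *v e = l *\<^sub>R e" using *(1) unfolding K_def by blast
    next
      fix v and l :: real
      assume "H *v v = l *\<^sub>R v" and v: "norm v = 1" "\<forall>e\<in>E. hinner e v = 0"
      then have "v \<in> K" unfolding K_def by blast
      with v show ?thesis by blast
    qed
  qed (auto simp: orthonormal_def)
  have fin: "finite E" and card: "card E = CARD('n)"
    using complete_orthonormal_resolution(2)[OF E(1,3)] orthonormal_bound(1)[OF E(1)] by auto
  then obtain b :: "'n \<Rightarrow> _" where b: "bij_betw b UNIV E"
    using finite_same_card_bij[OF finite fin] by auto
  define U where "U = (\<chi> i k. b k $ i)"
  have col: "column k U = b k" for k by (simp add: U_def column_chi)
  have bE: "b k \<in> E" for k using b by (auto simp: bij_betw_def)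
  have "unitary U"
    using E(1) bE b by (simp add: isometry_iff_columns col orthonormal_def bij_betw_def inj_eq)
  have "\<forall>k. \<exists>l :: real. H *v b k = l *\<^sub>R b k"
    using E(2) bE unfolding K_def by blast
  then obtain l :: "'n \<Rightarrow> real" where l: "\<And>k. H *v b k = l k *\<^sub>R b k"
    by metis
  have "H = H ** (\<Sum>k\<in>UNIV. ketbra (b k))"
    using unitary_resolution[OF \<open>unitary U\<close>] by (simp add: col)
  also have "\<dots> = (\<Sum>k\<in>UNIV. l k *\<^sub>R ketbra (b k))"
  proof -
    have "H ** ketbra (b k) = l k *\<^sub>R ketbra (b k)" for k
      unfolding matrix_eq
      by (simp add: ketbra_vec matrix_vec_smult l scaleR_matrix_vec flip: matrix_vector_mul_assoc)
        (simp add: vec_eq_iff)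
    then show ?thesis by (simp add: matrix_sum_right)
  qed
  finally show ?thesis using that[OF \<open>unitary U\<close>] by (simp add: col)
qed

lemma psd_spectral:
  fixes X :: "complex ^ 'n ^ 'n"
  assumes "psd X"
  obtains U l where "unitary U" "X = (\<Sum>j\<in>UNIV. l j *\<^sub>R ketbra (column j U))"
    "\<forall>j. l j = qform X (column j U)"
proof -
  obtain U l where U: "unitary U" and X: "X = (\<Sum>j\<in>UNIV. l j *\<^sub>R ketbra (column j U))"
    by (rule spectral_theorem[OF psd_imp_hermitian[OF assms]])
  have "l j = qform X (column j U)" for j
  proof -
    have "qform X (column j U) = (\<Sum>k\<in>UNIV. if k = j then l j else 0)"
      unfolding X qform_sum using U
      by (intro sum.cong refl) (auto simp: qform_scaleR qform_ketbra isometry_iff_columns)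
    then show ?thesis by simp
  qed
  then show ?thesis using that U X by blast
qed

lemma psd_sum_ketbra:
  fixes X :: "complex ^ 'n ^ 'n"
  assumes "psd X"
  obtains w :: "'n \<Rightarrow> complex ^ 'n" where "X = (\<Sum>j\<in>UNIV. ketbra (w j))"
proof -
  obtain U l where "unitary U" and X: "X = (\<Sum>j\<in>UNIV. l j *\<^sub>R ketbra (column j U))"
    and l: "\<forall>j. l j = qform X (column j U)"
    by (rule psd_spectral[OF assms])
  have "0 \<le> l j" for j
    using psd_qform_nonneg[OF assms, of "column j U"] l by simp
  then have "X = (\<Sum>j\<in>UNIV. ketbra (sqrt (l j) *\<^sub>R column j U))"
    unfolding X by (simp add: ketbra_scaleR)
  then show ?thesis by (rule that)
qed

subsection \<open>Relative entropy of finite families\<close>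

text \<open>For \<open>q = 0\<close> and \<open>p \<noteq> 0\<close> the value is a default and not
  the infinity of \<open>rel_entropy\<close>; the basic inequalities below therefore ask that
  \<open>q = 0\<close> force \<open>p = 0\<close>.\<close>

definition kl :: "real \<Rightarrow> real \<Rightarrow> real" where
  "kl p q = p * ln (p / q)"

lemma kl_0 [simp]: "kl 0 q = 0"
  by (simp add: kl_def)

text \<open>The factor cancels in the ratio. This homogeneity makes the entropy linear in the
  weights of the outcomes and allows vectors to be normalized.\<close>

lemma kl_mult: "kl (s * p) (s * q) = s * kl p q"
  by (cases "s = 0") (simp_all add: kl_def)

text \<open>This is \<open>ln x \<le> x - 1\<close> at \<open>x = q * l / p\<close>, with equality
  for \<open>l = p / q\<close>. After summation the corrections \<open>q * l - p\<close> cancel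
  whenever both parts have the same total.\<close>

lemma gibbs_term:
  fixes p q l :: real
  assumes "0 \<le> p" "0 \<le> q" "q = 0 \<Longrightarrow> p = 0" "0 < l"
  shows "p * ln l \<le> kl p q + q * l - p"
proof (cases "p = 0")
  case False
  with assms have pq: "0 < p" "0 < q" by (auto simp: order_less_le)
  have "ln (q * l / p) \<le> q * l / p - 1"
    using pq assms by (intro ln_le_minus_one) simp
  moreover have "ln (q * l / p) = ln l - ln (p / q)"
    using pq assms by (simp add: ln_div ln_mult)
  ultimately have "p * (ln l - ln (p / q)) \<le> p * (q * l / p - 1)"
    using pq by (intro mult_left_mono) auto
  then show ?thesis using pq by (simp add: kl_def algebra_simps)
qed (use assms in simp)

text \<open>Gibbs' inequality with the common value \<open>l = P / Q\<close>, for which the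
  corrections cancel.\<close>

lemma log_sum_inequality:
  assumes "\<And>i. i \<in> I \<Longrightarrow> 0 \<le> p i" "\<And>i. i \<in> I \<Longrightarrow> 0 \<le> q i" "\<And>i. i \<in> I \<Longrightarrow> q i = 0 \<Longrightarrow> p i = 0"
  shows "kl (\<Sum>i\<in>I. p i) (\<Sum>i\<in>I. q i) \<le> (\<Sum>i\<in>I. kl (p i) (q i))"
proof (cases "(\<Sum>i\<in>I. p i) = 0")
  case True
  then have "infinite I \<or> (\<forall>i\<in>I. p i = 0)"
    using assms(1) by (metis sum_nonneg_eq_0_iff)
  with True show ?thesis by auto
next
  case False
  define P where "P = (\<Sum>i\<in>I. p i)"
  define Q where "Q = (\<Sum>i\<in>I. q i)"
  have fin: "finite I" using False sum.infinite by blast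
  have "0 < P" using False assms(1) by (simp add: P_def sum_nonneg order_less_le)
  moreover have "0 < Q"
  proof -
    have "Q \<noteq> 0"
      using False assms fin by (auto simp: Q_def sum_nonneg_eq_0_iff)
    then show ?thesis using assms(2) by (simp add: Q_def sum_nonneg order_less_le)
  qed
  ultimately have PQ: "0 < P / Q" "Q * (P / Q) = P" by auto
  have "kl P Q = (\<Sum>i\<in>I. p i * ln (P / Q))"
    by (simp add: kl_def P_def sum_distrib_right)
  also have "\<dots> \<le> (\<Sum>i\<in>I. kl (p i) (q i) + q i * (P / Q) - p i)"
    using assms PQ by (intro sum_mono gibbs_term) auto
  also have "\<dots> = (\<Sum>i\<in>I. kl (p i) (q i)) + Q * (P / Q) - P"
    unfolding sum_subtractf sum.distrib sum_distrib_right[symmetric] Q_def P_def ..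
  finally show ?thesis using PQ by (simp add: P_def Q_def)
qed

subsection \<open>Traces against positive matrices\<close>

lemma trace_zero [simp]: "trace 0 = 0"
  by (simp add: trace_def)

lemma Re_trace_sum_ketbra: "Re (trace (R ** (\<Sum>k\<in>K. ketbra (m k)))) = (\<Sum>k\<in>K. qform R (m k))"
  by (simp add: matrix_sum_right trace_sum qform_eq_trace)

lemma Re_trace_nonneg:
  fixes R M :: "complex ^ 'n ^ 'n"
  assumes "psd R" "psd M"
  shows "0 \<le> Re (trace (R ** M))"
proof -
  obtain m :: "'n \<Rightarrow> complex ^ 'n" where "M = (\<Sum>k\<in>UNIV. ketbra (m k))" using psd_sum_ketbra[OF assms(2)] .
  then show ?thesis by (simp add: Re_trace_sum_ketbra psd_qform_nonneg assms(1) sum_nonneg)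
qed

lemma Re_trace_pos:
  fixes R M :: "complex ^ 'n ^ 'n"
  assumes R: "pos_full R" and "psd M" "M \<noteq> 0"
  shows "0 < Re (trace (R ** M))"
proof -
  obtain m :: "'n \<Rightarrow> complex ^ 'n" where M: "M = (\<Sum>k\<in>UNIV. ketbra (m k))" using psd_sum_ketbra[OF \<open>psd M\<close>] .
  have psd: "psd R" using R by (simp add: pos_full_def)
  have "Re (trace (R ** M)) \<noteq> 0"
  proof
    assume "Re (trace (R ** M)) = 0"
    then have "\<forall>k. qform R (m k) = 0"
      by (simp add: M Re_trace_sum_ketbra psd_qform_nonneg psd sum_nonneg_eq_0_iff)
    then have "m k = 0" for k using pos_full_qform_pos[OF R, of "m k"] by fastforce
    then have "M = 0" by (simp add: M)
    with \<open>M \<noteq> 0\<close> show False ..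
  qed
  with Re_trace_nonneg[OF psd \<open>psd M\<close>] show ?thesis by simp
qed

lemma unitary_sum_qform:
  assumes "unitary U"
  shows "(\<Sum>j\<in>UNIV. qform R (column j U)) = Re (trace R)"
  using Re_trace_sum_ketbra[of R "\<lambda>j. column j U" UNIV] unitary_resolution[OF assms] by simp

subsection \<open>Projective measurements attain the measured relative entropy\<close>

lemma qform_diff:
  assumes "psd X"
  shows "qform X (u - s *\<^sub>R v) = qform X u - 2 * s * Re (hinner u (X *v v)) + s\<^sup>2 * qform X v"
proof -
  have "Re (hinner v (X *v u)) = Re (hinner u (X *v v))"
    using cnj_hinner[of u "X *v v"] psd_imp_hermitian[OF assms]
    by (metis complex_cnj(1) hinner_matrix_right cnj.sel(1))
  then show ?thesis
    by (simp add: qform_def matrix_vector_mult_diff_distrib hinner_diff_left hinner_diff_right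
        matrix_vec_scaleR hinner_scaleR_left hinner_scaleR_right power2_eq_square algebra_simps)
qed

text \<open>Jensen's inequality for the inverse of the operator with eigenvalues \<open>l\<close>.
  With \<eta> the image of \<phi> under this inverse, the sum of the nonnegative numbers
  \<open>qform (M y) (\<phi> - w y *\<^sub>R \<eta>) / w y\<close> is expanded; the cross terms add
  up to -2 and the squares to +1 times the left-hand side.\<close>

lemma povm_jensen_inverse:
  assumes M: "povm Y M" and w: "\<And>y. y \<in> Y \<Longrightarrow> 0 < w y" and U: "unitary U"
    and l: "\<And>j. 0 < l j" and eq: "(\<Sum>y\<in>Y. w y *\<^sub>R M y) = (\<Sum>j\<in>UNIV. l j *\<^sub>R ketbra (column j U))"
  shows "(\<Sum>j\<in>UNIV. (cmod (hinner (column j U) \<phi>))\<^sup>2 / l j) \<le> (\<Sum>y\<in>Y. qform (M y) \<phi> / w y)"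
    (is "?r \<le> _")
proof -
  define \<eta> where "\<eta> = (\<Sum>j\<in>UNIV. (hinner (column j U) \<phi> / of_real (l j)) *s column j U)"
  have psd: "psd (M y)" if "y \<in> Y" for y using M that by (simp add: povm_def)
  have sumM: "(\<Sum>y\<in>Y. M y) = mat 1" using M by (simp add: povm_def)
  have coeff: "hinner (column k U) \<eta> = hinner (column k U) \<phi> / of_real (l k)" for k
  proof -
    have "hinner (column k U) \<eta>
        = (\<Sum>j\<in>UNIV. if j = k then hinner (column k U) \<phi> / of_real (l k) else 0)"
      unfolding \<eta>_def hinner_sum_right using U
      by (intro sum.cong refl) (auto simp: hinner_smult_right isometry_iff_columns)
    then show ?thesis by simp
  qed
  have "hinner \<phi> \<eta> = of_real ?r"
  proof -
    have "hinner \<phi> \<eta> = (\<Sum>j\<in>UNIV. hinner (column j U) \<phi> / of_real (l j) * cnj (hinner (column j U) \<phi>))"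
      by (simp add: \<eta>_def hinner_sum_right hinner_smult_right cnj_hinner)
    also have "\<dots> = (\<Sum>j\<in>UNIV. of_real ((cmod (hinner (column j U) \<phi>))\<^sup>2 / l j))"
      by (simp add: complex_norm_square del: of_real_power)
    finally show ?thesis by simp
  qed
  then have "Re (hinner \<phi> \<eta>) = ?r" by (simp only: Re_complex_of_real)
  then have cross: "(\<Sum>y\<in>Y. Re (hinner \<phi> (M y *v \<eta>))) = ?r"
    using sumM by (simp flip: Re_sum hinner_sum_right matrix_sum_vec)
  have "(\<Sum>y\<in>Y. w y * qform (M y) \<eta>) = qform (\<Sum>y\<in>Y. w y *\<^sub>R M y) \<eta>"
    by (simp add: qform_sum qform_scaleR)
  also have "\<dots> = ?r"
    unfolding eq qform_sum qform_scaleR qform_ketbra coeff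
    using l by (intro sum.cong refl) (simp add: norm_divide power_divide power2_eq_square less_imp_neq[symmetric])
  finally have quad: "(\<Sum>y\<in>Y. w y * qform (M y) \<eta>) = ?r" .
  have "0 \<le> (\<Sum>y\<in>Y. qform (M y) (\<phi> - w y *\<^sub>R \<eta>) / w y)"
    using w psd by (intro sum_nonneg divide_nonneg_pos psd_qform_nonneg)
  also have "\<dots> = (\<Sum>y\<in>Y. qform (M y) \<phi> / w y - 2 * Re (hinner \<phi> (M y *v \<eta>)) + w y * qform (M y) \<eta>)"
  proof (intro sum.cong refl)
    fix y assume y: "y \<in> Y"
    show "qform (M y) (\<phi> - w y *\<^sub>R \<eta>) / w y
        = qform (M y) \<phi> / w y - 2 * Re (hinner \<phi> (M y *v \<eta>)) + w y * qform (M y) \<eta>"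
      using w[OF y] by (simp add: qform_diff[OF psd[OF y]] field_simps power2_eq_square)
  qed
  also have "\<dots> = (\<Sum>y\<in>Y. qform (M y) \<phi> / w y) - ?r"
    by (simp add: sum.distrib sum_subtractf quad cross flip: sum_distrib_left)
  finally show ?thesis by simp
qed

lemma ln_shift_tendsto_0: "((\<lambda>t :: real. ln (c + t) - ln t) \<longlongrightarrow> 0) at_top"
proof -
  have "((\<lambda>t. c / t) \<longlongrightarrow> 0) at_top"
    by (intro tendsto_divide_0[OF tendsto_const] filterlim_at_top_imp_at_infinity filterlim_ident)
  then have "((\<lambda>t. ln (1 + c / t)) \<longlongrightarrow> ln (1 + 0)) at_top"
    by (intro tendsto_intros) auto
  moreover have "eventually (\<lambda>t. ln (1 + c / t) = ln (c + t) - ln t) at_top"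
    using eventually_gt_at_top[of "max 0 (- c)"]
  proof eventually_elim
    case (elim t)
    then have "1 + c / t = (c + t) / t" by (simp add: field_simps)
    with elim show ?case by (simp add: ln_div)
  qed
  ultimately show ?thesis
    by (simp add: filterlim_cong)
qed

text \<open>
  The operator Jensen inequality for \<open>ln\<close>: replacing \<open>w\<close> and \<open>l\<close> by \<open>w + t\<close> and \<open>l + t\<close>, the
  difference of both sides is nonincreasing in \<open>t\<close>, by the case of \<open>x \<mapsto> 1 / x\<close>, and tends to 0.
\<close>

lemma povm_jensen_ln:
  assumes M: "povm Y M" and w: "\<And>y. y \<in> Y \<Longrightarrow> 0 < w y" and U: "unitary U"
    and l: "\<And>j. 0 < l j" and eq: "(\<Sum>y\<in>Y. w y *\<^sub>R M y) = (\<Sum>j\<in>UNIV. l j *\<^sub>R ketbra (column j U))"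
  shows "(\<Sum>y\<in>Y. qform (M y) \<phi> * ln (w y)) \<le> (\<Sum>j\<in>UNIV. (cmod (hinner (column j U) \<phi>))\<^sup>2 * ln (l j))"
proof -
  define m where "m = (\<lambda>y. qform (M y) \<phi>)"
  define a where "a = (\<lambda>j. (cmod (hinner (column j U) \<phi>))\<^sup>2)"
  define f where "f = (\<lambda>t. (\<Sum>j\<in>UNIV. a j * ln (l j + t)) - (\<Sum>y\<in>Y. m y * ln (w y + t)))"
  have sumM: "(\<Sum>y\<in>Y. M y) = mat 1" using M by (simp add: povm_def)
  have mass: "(\<Sum>j\<in>UNIV. a j) = (\<Sum>y\<in>Y. m y)"
    unfolding a_def m_def qform_ketbra[symmetric] qform_sum[symmetric] sumM unitary_resolution[OF U] ..
  have deriv: "(\<Sum>j\<in>UNIV. a j / (l j + t)) \<le> (\<Sum>y\<in>Y. m y / (w y + t))" if "0 \<le> t" for t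
    unfolding a_def m_def
  proof (rule povm_jensen_inverse[OF M _ U])
    \<comment> \<open>Both families of operators sum to the identity, so shifting all
      \<open>w\<close> and \<open>l\<close> by \<open>t\<close> adds the same multiple of it on
      either side.\<close>
    show "(\<Sum>y\<in>Y. (w y + t) *\<^sub>R M y) = (\<Sum>j\<in>UNIV. (l j + t) *\<^sub>R ketbra (column j U))"
      by (simp add: scaleR_left_distrib sum.distrib eq sumM unitary_resolution[OF U]
          flip: scaleR_sum_right)
  qed (use w l that in \<open>auto intro: add_pos_nonneg\<close>)
  have mono: "f t \<le> f 0" if "0 \<le> t" for t
  proof (rule DERIV_nonpos_imp_nonincreasing[OF that])
    fix s assume s: "0 \<le> s" "s \<le> t"
    have "((\<lambda>s. a j * ln (l j + s)) has_real_derivative a j / (l j + s)) (at s)" for j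
      using l[of j] s by (auto intro!: derivative_eq_intros)
    moreover have "((\<lambda>s. m y * ln (w y + s)) has_real_derivative m y / (w y + s)) (at s)" if "y \<in> Y" for y
      using w[OF that] s by (auto intro!: derivative_eq_intros)
    ultimately have "(f has_real_derivative
        (\<Sum>j\<in>UNIV. a j / (l j + s)) - (\<Sum>y\<in>Y. m y / (w y + s))) (at s)"
      unfolding f_def by (intro DERIV_diff DERIV_sum)
    with deriv[OF s(1)] show "\<exists>d. (f has_real_derivative d) (at s) \<and> d \<le> 0" by force
  qed
  have "(f \<longlongrightarrow> 0) at_top"
  proof -
    \<comment> \<open>As the two families of weights have equal mass, \<open>ln t\<close> can be
      subtracted from every logarithm, and then each term tends to 0.\<close>
    have "f t = (\<Sum>j\<in>UNIV. a j * (ln (l j + t) - ln t)) - (\<Sum>y\<in>Y. m y * (ln (w y + t) - ln t))" for t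
      using mass by (simp add: f_def right_diff_distrib sum_subtractf flip: sum_distrib_right)
    then have "f = (\<lambda>t. (\<Sum>j\<in>UNIV. a j * (ln (l j + t) - ln t)) - (\<Sum>y\<in>Y. m y * (ln (w y + t) - ln t)))"
      by (rule ext)
    moreover have "((\<lambda>t. (\<Sum>j\<in>UNIV. a j * (ln (l j + t) - ln t)) - (\<Sum>y\<in>Y. m y * (ln (w y + t) - ln t)))
        \<longlongrightarrow> (\<Sum>j\<in>UNIV. a j * 0) - (\<Sum>y\<in>Y. m y * 0)) at_top"
      by (intro tendsto_intros ln_shift_tendsto_0)
    ultimately show ?thesis by simp
  qed
  moreover have "eventually (\<lambda>t. f t \<le> f 0) at_top"
    using eventually_ge_at_top[of 0] by eventually_elim (rule mono)
  ultimately have "0 \<le> f 0"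
    by (rule tendsto_upperbound) simp
  then show ?thesis by (simp add: f_def a_def m_def)
qed

text \<open>The basis to measure is the eigenbasis of \<omega>, the sum of the \<open>M y\<close>
  weighted by the likelihood ratios. Jensen's inequality bounds the entropy of \<open>M\<close> by
  the trace of R ln \<omega>, and Gibbs' inequality bounds the latter by the entropy in the
  eigenbasis. The Gibbs corrections cancel because the traces of S \<omega> and of R agree.\<close>

lemma projective_measurement_optimal:
  fixes R S :: "complex ^ 'n ^ 'n"
  assumes R: "pos_full R" and S: "pos_full S" and M: "povm Y M"
  obtains U where "unitary U"
    "(\<Sum>y\<in>Y. kl (Re (trace (R ** M y))) (Re (trace (S ** M y))))
      \<le> (\<Sum>j\<in>UNIV. kl (qform R (column j U)) (qform S (column j U)))"
proof -
  define p where "p = (\<lambda>y. Re (trace (R ** M y)))"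
  define q where "q = (\<lambda>y. Re (trace (S ** M y)))"
  \<comment> \<open>The value 1 at a vanishing \<open>M y\<close> keeps \<open>w\<close> positive;
    such an outcome contributes to no sum.\<close>
  define w where "w = (\<lambda>y. if M y = 0 then 1 else p y / q y)"
  have psd: "psd (M y)" if "y \<in> Y" for y using M that by (simp add: povm_def)
  have sumM: "(\<Sum>y\<in>Y. M y) = mat 1" and fin: "finite Y" using M by (simp_all add: povm_def)
  have pq: "0 < p y" "0 < q y" if "y \<in> Y" "M y \<noteq> 0" for y
    using Re_trace_pos[OF R psd[OF that(1)] that(2)] Re_trace_pos[OF S psd[OF that(1)] that(2)]
    by (simp_all add: p_def q_def)
  have w: "0 < w y" if "y \<in> Y" for y using pq that by (simp add: w_def)
  have qw: "q y * w y = p y" if "y \<in> Y" for y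
    using pq[OF that] by (cases "M y = 0") (auto simp: w_def p_def q_def)
  have kl_w: "kl (p y) (q y) = p y * ln (w y)" for y
    by (simp add: w_def kl_def p_def)
  define \<omega> where "\<omega> = (\<Sum>y\<in>Y. w y *\<^sub>R M y)"
  have "psd \<omega>" using w psd by (simp add: \<omega>_def psd_sum psd_scaleR less_imp_le)
  obtain U l where U: "unitary U" and \<omega>: "\<omega> = (\<Sum>j\<in>UNIV. l j *\<^sub>R ketbra (column j U))"
    and l_eq: "\<forall>j. l j = qform \<omega> (column j U)"
    by (rule psd_spectral[OF \<open>psd \<omega>\<close>])
  \<comment> \<open>Each eigenvalue is a convex combination of the positive \<open>w y\<close>, with
    the outcome probabilities of the eigenvector as coefficients.\<close>
  have l: "0 < l j" for j
  proof -
    define m where "m = (\<lambda>y. qform (M y) (column j U))"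
    have m: "0 \<le> m y" if "y \<in> Y" for y using psd_qform_nonneg[OF psd[OF that]] by (simp add: m_def)
    have "hinner (column j U) (column j U) = 1" using U by (simp add: isometry_iff_columns)
    then have "(\<Sum>y\<in>Y. m y) = 1"
      unfolding m_def qform_sum[symmetric] sumM by (simp add: qform_def)
    moreover have eq: "l j = (\<Sum>y\<in>Y. w y * m y)"
      using l_eq by (simp add: \<omega>_def qform_sum qform_scaleR m_def)
    have "l j \<noteq> 0"
    proof
      assume "l j = 0"
      then have "\<forall>y\<in>Y. w y * m y = 0"
        using eq fin w m by (simp add: sum_nonneg_eq_0_iff less_imp_le)
      then have "\<forall>y\<in>Y. m y = 0" using w by fastforce
      then have "(\<Sum>y\<in>Y. m y) = 0" by simp
      with \<open>(\<Sum>y\<in>Y. m y) = 1\<close> show False by simp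
    qed
    moreover have "0 \<le> l j" unfolding eq using w m by (intro sum_nonneg mult_nonneg_nonneg) (auto intro: less_imp_le)
    ultimately show ?thesis by simp
  qed
  \<comment> \<open>Jensen's inequality concerns one vector at a time, so \<open>R\<close> is split
    into rank-one terms.\<close>
  obtain r :: "'n \<Rightarrow> complex ^ 'n" where r: "R = (\<Sum>k\<in>UNIV. ketbra (r k))"
    using R unfolding pos_full_def by (elim conjE psd_sum_ketbra)
  define p' where "p' = (\<lambda>j. qform R (column j U))"
  define q' where "q' = (\<lambda>j. qform S (column j U))"
  have R_trace: "Re (trace (R ** X)) = (\<Sum>k\<in>UNIV. qform X (r k))" for X
    unfolding r by (subst trace_mul_sym) (rule Re_trace_sum_ketbra)
  have e_nz: "column j U \<noteq> 0" for j
    using U by (metis hinner_zero_left isometry_iff_columns zero_neq_one)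
  have p'q': "0 < p' j" "0 < q' j" for j
    using pos_full_qform_pos[OF R e_nz] pos_full_qform_pos[OF S e_nz] by (simp_all add: p'_def q'_def)
  have "(\<Sum>y\<in>Y. kl (p y) (q y)) = (\<Sum>k\<in>UNIV. \<Sum>y\<in>Y. qform (M y) (r k) * ln (w y))"
    unfolding kl_w unfolding p_def R_trace sum_distrib_right by (rule sum.swap)
  also have "\<dots> \<le> (\<Sum>k\<in>UNIV. \<Sum>j\<in>UNIV. (cmod (hinner (column j U) (r k)))\<^sup>2 * ln (l j))"
    using povm_jensen_ln[OF M w U l] \<omega> by (intro sum_mono) (simp add: \<omega>_def)
  also have "\<dots> = (\<Sum>j\<in>UNIV. p' j * ln (l j))"
    unfolding p'_def qform_eq_trace[of R] R_trace qform_ketbra sum_distrib_right by (rule sum.swap)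
  also have "\<dots> \<le> (\<Sum>j\<in>UNIV. kl (p' j) (q' j) + q' j * l j - p' j)"
    using p'q' l by (intro sum_mono gibbs_term) (auto intro: less_imp_le simp: order_less_imp_not_eq2)
  also have "\<dots> = (\<Sum>j\<in>UNIV. kl (p' j) (q' j)) + ((\<Sum>j\<in>UNIV. q' j * l j) - (\<Sum>j\<in>UNIV. p' j))"
    by (simp add: sum.distrib sum_subtractf)
  also have "(\<Sum>j\<in>UNIV. q' j * l j) = Re (trace (S ** \<omega>))"
    unfolding \<omega> q'_def qform_eq_trace
    by (simp add: matrix_sum_right matrix_scaleR_right trace_sum trace_scaleR mult.commute)
  also have "\<dots> = (\<Sum>y\<in>Y. q y * w y)"
    by (simp add: \<omega>_def q_def matrix_sum_right matrix_scaleR_right trace_sum trace_scaleR mult.commute)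
  also have "\<dots> = (\<Sum>y\<in>Y. p y)" using qw by simp
  also have "\<dots> = Re (trace R)"
    by (simp add: p_def sumM flip: Re_sum trace_sum matrix_sum_right)
  also have "(\<Sum>j\<in>UNIV. p' j) = Re (trace R)"
    using unitary_sum_qform[OF U] by (simp add: p'_def)
  finally show ?thesis using that[OF U] by (simp add: p_def q_def p'_def q'_def)
qed

subsection \<open>Reducing the number of outcomes\<close>

text \<open>Moving the weights along a linear relation \<open>c\<close> between the vectors
  preserves their weighted sum. The positive functional \<phi> forbids a nonzero relation with only
  nonnegative coefficients, so some weight decreases and reaches zero.\<close>

lemma caratheodory_reduce_once:
  fixes a :: "'i \<Rightarrow> 'v :: euclidean_space" and g t :: "'i \<Rightarrow> real"
  assumes fin: "finite I" and t: "\<And>i. i \<in> I \<Longrightarrow> 0 < t i"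
    and \<phi>: "linear \<phi>" "\<And>i. i \<in> I \<Longrightarrow> 0 < (\<phi> (a i) :: real)" and big: "DIM('v) < card I"
  shows "\<exists>t'. (\<forall>i\<in>I. 0 \<le> t' i) \<and> (\<exists>i\<in>I. t' i = 0)
    \<and> (\<Sum>i\<in>I. t' i *\<^sub>R a i) = (\<Sum>i\<in>I. t i *\<^sub>R a i) \<and> (\<Sum>i\<in>I. t i * g i) \<le> (\<Sum>i\<in>I. t' i * g i)"
proof -
  have "\<exists>c. (\<exists>i\<in>I. c i \<noteq> 0) \<and> (\<Sum>i\<in>I. c i *\<^sub>R a i) = 0"
  proof (cases "inj_on a I")
    case True
    then have "dependent (a ` I)"
      using big by (intro dependent_biggerset) (simp add: card_image)
    then obtain u v where u: "v \<in> a ` I" "u v \<noteq> 0" "(\<Sum>v\<in>a ` I. u v *\<^sub>R v) = 0"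
      using fin by (auto simp: dependent_finite)
    then show ?thesis
      by (intro exI[of _ "u \<circ> a"]) (auto simp: sum.reindex[OF True])
  next
    case False
    \<comment> \<open>A repeated vector is invisible to dependence of the image set; it gives the
      relation \<open>a i - a j = 0\<close> directly.\<close>
    then obtain i j where ij: "i \<in> I" "j \<in> I" "i \<noteq> j" "a i = a j" by (auto simp: inj_on_def)
    define c where "c = (\<lambda>k. if k = i then 1 else if k = j then - 1 else 0 :: real)"
    have "(\<Sum>k\<in>I. c k *\<^sub>R a k) = (\<Sum>k\<in>I. (if k = i then a i else 0) + (if k = j then - a j else 0))"
      using ij by (intro sum.cong) (auto simp: c_def)
    also have "\<dots> = 0" using ij fin by (simp add: sum.distrib)
    finally show ?thesis using ij by (intro exI[of _ c]) (auto simp: c_def)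
  qed
  then obtain c0 where c0: "\<exists>i\<in>I. c0 i \<noteq> 0" "(\<Sum>i\<in>I. c0 i *\<^sub>R a i) = 0" by blast
  \<comment> \<open>The sign of the relation is chosen so that the objective does not decrease along
    it.\<close>
  define c where "c = (if 0 \<le> (\<Sum>i\<in>I. c0 i * g i) then c0 else (\<lambda>i. - c0 i))"
  have c: "\<exists>i\<in>I. c i \<noteq> 0" "(\<Sum>i\<in>I. c i *\<^sub>R a i) = 0" "0 \<le> (\<Sum>i\<in>I. c i * g i)"
    using c0 by (auto simp: c_def sum_negf)
  define N where "N = {i\<in>I. c i < 0}"
  have "N \<noteq> {}"
  proof
    assume "N = {}"
    then have nonneg: "0 \<le> c i" if "i \<in> I" for i using that by (force simp: N_def)
    have "(\<Sum>i\<in>I. c i * \<phi> (a i)) = \<phi> (\<Sum>i\<in>I. c i *\<^sub>R a i)"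
      by (simp add: linear_sum[OF \<phi>(1)] linear_scale[OF \<phi>(1)])
    also have "\<dots> = 0" using c(2) linear_0[OF \<phi>(1)] by simp
    finally have "\<forall>i\<in>I. c i * \<phi> (a i) = 0"
      using nonneg \<phi>(2) fin
      by (subst (asm) sum_nonneg_eq_0_iff) (auto intro!: mult_nonneg_nonneg intro: less_imp_le)
    with c(1) \<phi>(2) show False by fastforce
  qed
  moreover have "finite N" using fin by (simp add: N_def)
  ultimately have arg_min: "arg_min_on (\<lambda>i. t i / - c i) N \<in> N"
    "\<not> (\<exists>i\<in>N. t i / - c i < t (arg_min_on (\<lambda>i. t i / - c i) N) / - c (arg_min_on (\<lambda>i. t i / - c i) N))"
    using arg_min_if_finite[of N "\<lambda>i. t i / - c i"] by auto
  define k where "k = arg_min_on (\<lambda>i. t i / - c i) N"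
  have k: "k \<in> N" and min: "\<And>i. i \<in> N \<Longrightarrow> t k / - c k \<le> t i / - c i"
    using arg_min unfolding k_def by force+
  \<comment> \<open>The largest step that leaves all weights nonnegative; the weight of the
    minimizer \<open>k\<close> becomes zero.\<close>
  define s where "s = t k / - c k"
  have s: "0 < s" using k t by (auto simp: s_def N_def divide_less_0_iff)
  define t' where "t' = (\<lambda>i. t i + s * c i)"
  show ?thesis
  proof (intro exI[of _ t'] conjI ballI)
    show "0 \<le> t' i" if "i \<in> I" for i
    proof (cases "c i < 0")
      case True
      with min[of i] that have "s \<le> t i / - c i" by (simp add: N_def s_def)
      with True show ?thesis by (simp add: t'_def field_simps)
    next
      case False
      then show ?thesis using t[OF that] s by (simp add: t'_def)
    qed
    show "\<exists>i\<in>I. t' i = 0"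
      using k by (intro bexI[of _ k]) (auto simp: N_def t'_def s_def)
    have "(\<Sum>i\<in>I. t' i *\<^sub>R a i) = (\<Sum>i\<in>I. t i *\<^sub>R a i) + s *\<^sub>R (\<Sum>i\<in>I. c i *\<^sub>R a i)"
      by (simp add: t'_def scaleR_left_distrib sum.distrib scaleR_sum_right)
    then show "(\<Sum>i\<in>I. t' i *\<^sub>R a i) = (\<Sum>i\<in>I. t i *\<^sub>R a i)" by (simp add: c)
    have "(\<Sum>i\<in>I. t' i * g i) = (\<Sum>i\<in>I. t i * g i) + s * (\<Sum>i\<in>I. c i * g i)"
      by (simp add: t'_def sum.distrib sum_distrib_left algebra_simps)
    then show "(\<Sum>i\<in>I. t i * g i) \<le> (\<Sum>i\<in>I. t' i * g i)" using c s by simp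
  qed
qed

text \<open>The reduction step is repeated while more weights than the dimension are nonzero; their
  number strictly drops each time.\<close>

lemma caratheodory_maximize:
  fixes a :: "'i \<Rightarrow> 'v :: euclidean_space" and g :: "'i \<Rightarrow> real"
  assumes fin: "finite I" and \<phi>: "linear \<phi>" "\<And>i. i \<in> I \<Longrightarrow> 0 < (\<phi> (a i) :: real)"
    and t: "\<And>i. i \<in> I \<Longrightarrow> 0 \<le> t i"
  shows "\<exists>t'. (\<forall>i\<in>I. 0 \<le> t' i) \<and> card {i\<in>I. t' i \<noteq> 0} \<le> DIM('v)
    \<and> (\<Sum>i\<in>I. t' i *\<^sub>R a i) = (\<Sum>i\<in>I. t i *\<^sub>R a i) \<and> (\<Sum>i\<in>I. t i * g i) \<le> (\<Sum>i\<in>I. t' i * g i)"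
  using t
proof (induction "card {i\<in>I. t i \<noteq> 0}" arbitrary: t rule: less_induct)
  case less
  define J where "J = {i\<in>I. t i \<noteq> 0}"
  have J: "finite J" "J \<subseteq> I" using fin by (auto simp: J_def)
  show ?case
  proof (cases "card J \<le> DIM('v)")
    case True
    with less.prems show ?thesis by (intro exI[of _ t]) (simp add: J_def)
  next
    case False
    then have big: "DIM('v) < card J" by simp
    have tpos: "0 < t i" if "i \<in> J" for i
      using that less.prems[of i] by (auto simp: J_def order_less_le)
    have \<phi>J: "0 < \<phi> (a i)" if "i \<in> J" for i using that \<phi>(2) J by auto
    have "\<exists>t1. (\<forall>i\<in>J. 0 \<le> t1 i) \<and> (\<exists>i\<in>J. t1 i = 0)
      \<and> (\<Sum>i\<in>J. t1 i *\<^sub>R a i) = (\<Sum>i\<in>J. t i *\<^sub>R a i) \<and> (\<Sum>i\<in>J. t i * g i) \<le> (\<Sum>i\<in>J. t1 i * g i)"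
      by (rule caratheodory_reduce_once[OF J(1) tpos \<phi>(1) \<phi>J big])
    then obtain t1 where t1: "\<forall>i\<in>J. 0 \<le> t1 i" "\<exists>i\<in>J. t1 i = 0"
      "(\<Sum>i\<in>J. t1 i *\<^sub>R a i) = (\<Sum>i\<in>J. t i *\<^sub>R a i)" "(\<Sum>i\<in>J. t i * g i) \<le> (\<Sum>i\<in>J. t1 i * g i)"
      by (elim exE conjE)
    define t2 where "t2 = (\<lambda>i. if i \<in> J then t1 i else 0)"
    have "{i\<in>I. t2 i \<noteq> 0} \<subset> J" using t1(2) J(2) by (auto simp: t2_def)
    then have "card {i\<in>I. t2 i \<noteq> 0} < card J" using J by (simp add: psubset_card_mono)
    moreover have "0 \<le> t2 i" if "i \<in> I" for i using t1 by (simp add: t2_def)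
    ultimately have "\<exists>t'. (\<forall>i\<in>I. 0 \<le> t' i) \<and> card {i\<in>I. t' i \<noteq> 0} \<le> DIM('v)
      \<and> (\<Sum>i\<in>I. t' i *\<^sub>R a i) = (\<Sum>i\<in>I. t2 i *\<^sub>R a i) \<and> (\<Sum>i\<in>I. t2 i * g i) \<le> (\<Sum>i\<in>I. t' i * g i)"
      by (rule less.hyps[of t2, folded J_def])
    then obtain t' where t': "\<forall>i\<in>I. 0 \<le> t' i" "card {i\<in>I. t' i \<noteq> 0} \<le> DIM('v)"
      "(\<Sum>i\<in>I. t' i *\<^sub>R a i) = (\<Sum>i\<in>I. t2 i *\<^sub>R a i)" "(\<Sum>i\<in>I. t2 i * g i) \<le> (\<Sum>i\<in>I. t' i * g i)"
      by (elim exE conjE)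
    have t2: "(\<Sum>i\<in>I. t2 i *\<^sub>R a i) = (\<Sum>i\<in>J. t1 i *\<^sub>R a i)" "(\<Sum>i\<in>I. t2 i * g i) = (\<Sum>i\<in>J. t1 i * g i)"
      using J fin by (auto intro!: sum.mono_neutral_cong_right simp: t2_def)
    have t: "(\<Sum>i\<in>I. t i *\<^sub>R a i) = (\<Sum>i\<in>J. t i *\<^sub>R a i)" "(\<Sum>i\<in>I. t i * g i) = (\<Sum>i\<in>J. t i * g i)"
      using J fin by (auto intro!: sum.mono_neutral_right simp: J_def)
    show ?thesis
    proof (intro exI[of _ t'] conjI)
      show "(\<Sum>i\<in>I. t' i *\<^sub>R a i) = (\<Sum>i\<in>I. t i *\<^sub>R a i)"
        by (simp only: t'(3) t2(1) t1(3) t(1))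
      show "(\<Sum>i\<in>I. t i * g i) \<le> (\<Sum>i\<in>I. t' i * g i)"
        using t'(4) t1(4) by (simp only: t2(2) t(2))
    qed (use t' in auto)
  qed
qed

text \<open>
  Adding real and imaginary parts is injective on Hermitian matrices, which realizes their
  real dimension \<open>n\<^sup>2\<close>.
\<close>

definition herm_vec :: "complex ^ 'n ^ 'n \<Rightarrow> real ^ ('n \<times> 'n)" where
  "herm_vec X = (\<chi> k. Re (X $ fst k $ snd k) + Im (X $ fst k $ snd k))"

lemma linear_herm_vec: "linear herm_vec"
  by (rule linearI) (simp_all add: herm_vec_def vec_eq_iff algebra_simps)

text \<open>In a Hermitian matrix the entries at \<open>(i, j)\<close> and \<open>(j, i)\<close> are
  conjugate, so their images are \<open>Re + Im\<close> and \<open>Re - Im\<close> of one number and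
  determine it.\<close>

lemma herm_vec_inject:
  assumes eq: "herm_vec X = herm_vec Y" and X: "dagger X = X" and Y: "dagger Y = Y"
  shows "X = Y"
proof -
  have "X $ i $ j = Y $ i $ j" for i j
  proof -
    have nth: "Re (X $ i $ j) + Im (X $ i $ j) = Re (Y $ i $ j) + Im (Y $ i $ j)" for i j
      using arg_cong[OF eq, of "\<lambda>v. v $ (i, j)"] by (simp add: herm_vec_def)
    have "X $ j $ i = cnj (X $ i $ j)" "Y $ j $ i = cnj (Y $ i $ j)"
      by (subst X[symmetric], simp add: dagger_def) (subst Y[symmetric], simp add: dagger_def)
    with nth[of i j] nth[of j i] show ?thesis by (simp add: complex_eq_iff)
  qed
  then show ?thesis by (simp add: vec_eq_iff)
qed

lemma caratheodory_ketbra: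
  fixes v :: "'i \<Rightarrow> complex ^ 'n" and g :: "'i \<Rightarrow> real"
  assumes fin: "finite I" and v: "\<And>i. i \<in> I \<Longrightarrow> v i \<noteq> 0" and t: "\<And>i. i \<in> I \<Longrightarrow> 0 \<le> t i"
  obtains t' where "\<forall>i\<in>I. 0 \<le> t' i" "card {i\<in>I. t' i \<noteq> 0} \<le> CARD('n)\<^sup>2"
    "(\<Sum>i\<in>I. t' i *\<^sub>R ketbra (v i)) = (\<Sum>i\<in>I. t i *\<^sub>R ketbra (v i))"
    "(\<Sum>i\<in>I. t i * g i) \<le> (\<Sum>i\<in>I. t' i * g i)"
proof -
  \<comment> \<open>This is the trace in disguise, as Hermitian matrices have a real diagonal; it is
    positive on \<open>ketbra (v i)\<close>.\<close>
  define \<phi> where "\<phi> = (\<lambda>x :: real ^ ('n \<times> 'n). \<Sum>i\<in>UNIV. x $ (i, i))"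
  have "linear \<phi>"
    by (rule linearI) (simp_all add: \<phi>_def sum.distrib sum_distrib_left)
  moreover have "0 < \<phi> (herm_vec (ketbra (v i)))" if "i \<in> I" for i
  proof -
    have "\<phi> (herm_vec (ketbra (v i))) = Re (trace (ketbra (v i))) + Im (trace (ketbra (v i)))"
      by (simp add: \<phi>_def herm_vec_def trace_def sum.distrib)
    then show ?thesis using v[OF that] by (simp add: trace_ketbra_1)
  qed
  ultimately have "\<exists>t'. (\<forall>i\<in>I. 0 \<le> t' i) \<and> card {i\<in>I. t' i \<noteq> 0} \<le> DIM(real ^ ('n \<times> 'n))
    \<and> (\<Sum>i\<in>I. t' i *\<^sub>R herm_vec (ketbra (v i))) = (\<Sum>i\<in>I. t i *\<^sub>R herm_vec (ketbra (v i)))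
    \<and> (\<Sum>i\<in>I. t i * g i) \<le> (\<Sum>i\<in>I. t' i * g i)"
    using t by (rule caratheodory_maximize[OF fin, where g = g and a = "\<lambda>i. herm_vec (ketbra (v i))"])
  then obtain t' where t': "\<forall>i\<in>I. 0 \<le> t' i"
    "card {i\<in>I. t' i \<noteq> 0} \<le> DIM(real ^ ('n \<times> 'n))"
    "(\<Sum>i\<in>I. t' i *\<^sub>R herm_vec (ketbra (v i))) = (\<Sum>i\<in>I. t i *\<^sub>R herm_vec (ketbra (v i)))"
    "(\<Sum>i\<in>I. t i * g i) \<le> (\<Sum>i\<in>I. t' i * g i)"
    by (elim exE conjE)
  have herm: "dagger (\<Sum>i\<in>I. s i *\<^sub>R ketbra (v i)) = (\<Sum>i\<in>I. s i *\<^sub>R ketbra (v i))"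
    if "\<forall>i\<in>I. 0 \<le> s i" for s
    using that by (intro psd_imp_hermitian psd_sum psd_scaleR psd_ketbra) auto
  have hv: "herm_vec (\<Sum>i\<in>I. s i *\<^sub>R ketbra (v i)) = (\<Sum>i\<in>I. s i *\<^sub>R herm_vec (ketbra (v i)))" for s
    by (simp add: linear_sum[OF linear_herm_vec] linear_scale[OF linear_herm_vec])
  have eq: "(\<Sum>i\<in>I. t' i *\<^sub>R ketbra (v i)) = (\<Sum>i\<in>I. t i *\<^sub>R ketbra (v i))"
  proof (rule herm_vec_inject)
    show "herm_vec (\<Sum>i\<in>I. t' i *\<^sub>R ketbra (v i)) = herm_vec (\<Sum>i\<in>I. t i *\<^sub>R ketbra (v i))"
      by (simp only: hv t'(3))
  qed (rule herm, use t'(1) t in blast)+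
  have "card {i\<in>I. t' i \<noteq> 0} \<le> CARD('n)\<^sup>2"
    using t'(2) by (simp add: power2_eq_square)
  then show ?thesis by (rule that[OF t'(1) _ eq t'(4)])
qed

subsection \<open>Tensor products\<close>

lemma kron_nth: "(A \<otimes>\<^sub>K B) $ i $ j = A $ fst i $ fst j * B $ snd i $ snd j"
  by (simp add: kron_def)

lemma sum_UNIV_prod: "(\<Sum>k\<in>UNIV. f (fst k) * g (snd k)) = (\<Sum>i\<in>UNIV. f i) * (\<Sum>j\<in>UNIV. g j)"
  for f :: "'a::finite \<Rightarrow> 'c :: semiring_0" and g :: "'b::finite \<Rightarrow> 'c"
  by (simp add: sum_product sum.cartesian_product case_prod_unfold)

lemma kron_mult: "(A \<otimes>\<^sub>K B) ** (C \<otimes>\<^sub>K D) = (A ** C) \<otimes>\<^sub>K (B ** D)"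
  by (simp add: vec_eq_iff kron_nth matrix_matrix_mult_def mult_ac flip: sum_UNIV_prod)

lemma dagger_kron: "dagger (A \<otimes>\<^sub>K B) = dagger A \<otimes>\<^sub>K dagger B"
  by (simp add: vec_eq_iff kron_nth dagger_def)

lemma kron_sum_left: "(\<Sum>i\<in>I. f i) \<otimes>\<^sub>K B = (\<Sum>i\<in>I. f i \<otimes>\<^sub>K B)"
  by (simp add: vec_eq_iff kron_nth sum_distrib_right)

lemma kron_sum_right: "A \<otimes>\<^sub>K (\<Sum>i\<in>I. f i) = (\<Sum>i\<in>I. A \<otimes>\<^sub>K f i)"
  by (simp add: vec_eq_iff kron_nth sum_distrib_left)

lemma kron_scaleR_left: "(r *\<^sub>R A) \<otimes>\<^sub>K B = r *\<^sub>R (A \<otimes>\<^sub>K B)"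
  and kron_scaleR_right: "A \<otimes>\<^sub>K (r *\<^sub>R B) = r *\<^sub>R (A \<otimes>\<^sub>K B)"
  and kron_0_left [simp]: "0 \<otimes>\<^sub>K B = 0"
  and kron_0_right [simp]: "A \<otimes>\<^sub>K 0 = 0"
  by (simp_all add: vec_eq_iff kron_nth)

lemma kron_mat_1: "mat 1 \<otimes>\<^sub>K mat 1 = mat 1"
  by (auto simp: vec_eq_iff kron_nth mat_def prod_eq_iff)

lemma kron_eq_0: "A \<otimes>\<^sub>K B = 0 \<longleftrightarrow> A = 0 \<or> B = 0"
  by (fastforce simp: vec_eq_iff kron_nth)

definition tens :: "complex ^ 'a \<Rightarrow> complex ^ 'b \<Rightarrow> complex ^ ('a \<times> 'b)" where
  "tens v u = (\<chi> k. v $ fst k * u $ snd k)"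

lemma ketbra_tens: "ketbra v \<otimes>\<^sub>K ketbra u = ketbra (tens v u)"
  by (simp add: vec_eq_iff kron_nth ketbra_def tens_def mult_ac)

lemma hinner_tens: "hinner (tens a b) (tens c d) = hinner a c * hinner b d"
  by (simp add: hinner_def tens_def mult_ac flip: sum_UNIV_prod)

lemma tens_eq_0: "tens v u = 0 \<longleftrightarrow> v = 0 \<or> u = 0"
  by (fastforce simp: vec_eq_iff tens_def)

lemma tens_scaleR_left: "tens (r *\<^sub>R v) u = r *\<^sub>R tens v u"
  by (simp add: vec_eq_iff tens_def)

lemma psd_kron:
  fixes A :: "complex ^ 'a ^ 'a" and B :: "complex ^ 'b ^ 'b"
  assumes "psd A" "psd B"
  shows "psd (A \<otimes>\<^sub>K B)"
proof -
  obtain v :: "'a \<Rightarrow> complex ^ 'a" where A: "A = (\<Sum>i\<in>UNIV. ketbra (v i))"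
    by (rule psd_sum_ketbra[OF assms(1)])
  obtain u :: "'b \<Rightarrow> complex ^ 'b" where B: "B = (\<Sum>i\<in>UNIV. ketbra (u i))"
    by (rule psd_sum_ketbra[OF assms(2)])
  show ?thesis
    unfolding A B kron_sum_left kron_sum_right ketbra_tens by (intro psd_sum psd_ketbra)
qed

section \<open>Operators on B conditioned on a vector of A\<close>

definition slice :: "complex ^ 'a \<Rightarrow> complex ^ 'b ^ ('a \<times> 'b)" where
  "slice v = (\<chi> i j. if snd i = j then v $ fst i else 0)"

lemma slice_vec: "slice v *v u = tens v u"
  by (simp add: slice_def tens_def vec_eq_iff matrix_vector_mult_def if_distrib if_distribR cong: if_cong)

lemma slice_conj: "slice v ** M ** dagger (slice v) = ketbra v \<otimes>\<^sub>K M"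
  by (simp add: slice_def dagger_def ketbra_def vec_eq_iff matrix_matrix_mult_def kron_nth
      if_distrib if_distribR mult_ac cong: if_cong)

text \<open>The unnormalized operator that remains on B after the outcome \<open>ketbra v\<close> on
  A. Written as a compression instead of a partial trace, it visibly inherits positivity and full
  support.\<close>

definition conditional :: "complex ^ ('a \<times> 'b) ^ ('a \<times> 'b) \<Rightarrow> complex ^ 'a \<Rightarrow> complex ^ 'b ^ 'b" where
  "conditional X v = dagger (slice v) ** X ** slice v"

lemma qform_conditional: "qform (conditional X v) u = qform X (tens v u)"
  by (simp add: conditional_def qform_conj slice_vec)

lemma trace_conditional: "trace (conditional X v ** M) = trace (X ** (ketbra v \<otimes>\<^sub>K M))"
proof -
  have "trace (conditional X v ** M) = trace (dagger (slice v) ** (X ** slice v ** M))"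
    by (simp add: conditional_def matrix_mul_assoc)
  also have "\<dots> = trace (X ** slice v ** M ** dagger (slice v))"
    by (rule trace_mul_sym)
  finally show ?thesis by (simp add: matrix_mul_assoc flip: slice_conj)
qed

lemma pos_full_conditional:
  assumes "pos_full X" "v \<noteq> 0"
  shows "pos_full (conditional X v)"
proof (rule qform_pos_imp_pos_full)
  show "psd (conditional X v)"
    using assms(1) by (simp add: conditional_def psd_conj pos_full_def)
  show "0 < qform (conditional X v) u" if "u \<noteq> 0" for u
    using assms that by (simp add: qform_conditional pos_full_qform_pos tens_eq_0)
qed

lemma trace_zero_pos_full:
  assumes "pos_full S" "psd M" "Re (trace (S ** M)) = 0"
  shows "M = 0"
  using Re_trace_pos[OF assms(1,2)] assms(3) by force

subsection \<open>One-way measurements with a rank-one first step\<close>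

text \<open>
  A point \<open>(t, n, U)\<close> encodes the measurement of \<open>A\<close> by \<open>t\<^sub>x |n\<^sub>x\<rangle>\<langle>n\<^sub>x|\<close> followed, for outcome \<open>x\<close>,
  by that of \<open>B\<close> in the basis of columns of \<open>U\<^sub>x\<close>. Keeping the weight \<open>t\<^sub>x\<close> apart from the unit vector
  \<open>n\<^sub>x\<close> makes \<open>outcome_entropy\<close> continuous also where \<open>t\<^sub>x = 0\<close>.
\<close>

definition one_way_params ::
    "((real ^ 'c) \<times> (complex ^ 'a ^ 'c) \<times> (complex ^ 'b ^ 'b ^ 'c)) set" where
  "one_way_params = {(t, n, U). (\<forall>x. 0 \<le> t $ x \<and> norm (n $ x) = 1 \<and> unitary (U $ x))
     \<and> (\<Sum>x\<in>UNIV. (t $ x) *\<^sub>R ketbra (n $ x)) = mat 1}"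

definition outcome_entropy ::
    "complex ^ ('a \<times> 'b) ^ ('a \<times> 'b) \<Rightarrow> complex ^ ('a \<times> 'b) ^ ('a \<times> 'b)
      \<Rightarrow> (real ^ 'c) \<times> (complex ^ 'a ^ 'c) \<times> (complex ^ 'b ^ 'b ^ 'c) \<Rightarrow> real" where
  "outcome_entropy \<rho> \<sigma> = (\<lambda>(t, n, U). \<Sum>x\<in>UNIV. t $ x *
     (\<Sum>y\<in>UNIV. kl (qform \<rho> (tens (n $ x) (column y (U $ x)))) (qform \<sigma> (tens (n $ x) (column y (U $ x))))))"

lemma unitary_column_norm: "unitary U \<Longrightarrow> norm (column j U) = 1"
  using hinner_self[of "column j U"] norm_ge_zero[of "column j U"]
  by (auto simp: isometry_iff_columns power2_eq_1_iff simp flip: of_real_power)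

lemma unitary_column_nonzero: "unitary U \<Longrightarrow> column j U \<noteq> 0"
  using unitary_column_norm[of U j] by auto

text \<open>In coordinates the set is cut out by continuous equations and weak inequalities. It is
  bounded because the vectors and columns are units and the trace of the resolution of the identity
  makes the weights sum to the dimension of A.\<close>

lemma compact_one_way_params:
  "compact (one_way_params :: ((real ^ 'c) \<times> (complex ^ 'a ^ 'c) \<times> (complex ^ 'b ^ 'b ^ 'c)) set)"
proof (rule compact_eq_bounded_closed[THEN iffD2], intro conjI)
  have mem: "(t, n, U) \<in> one_way_params \<longleftrightarrow>
      (\<forall>x. 0 \<le> t $ x) \<and> (\<forall>x. norm (n $ x) = 1)
      \<and> (\<forall>x i j. (\<Sum>k\<in>UNIV. cnj (U $ x $ k $ i) * U $ x $ k $ j) = (if i = j then 1 else 0))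
      \<and> (\<forall>i j. (\<Sum>x\<in>UNIV. of_real (t $ x) * (n $ x $ i * cnj (n $ x $ j))) = (if i = j then 1 else 0))"
    for t :: "real ^ 'c" and n :: "complex ^ 'a ^ 'c" and U :: "complex ^ 'b ^ 'b ^ 'c"
    unfolding one_way_params_def isometry_iff_columns hinner_def column_def
    by (auto simp: vec_eq_iff ketbra_def mat_def scaleR_conv_of_real[where 'a = complex])
  have eq: "(one_way_params :: ((real ^ 'c) \<times> (complex ^ 'a ^ 'c) \<times> (complex ^ 'b ^ 'b ^ 'c)) set) =
      {p. (\<forall>x. 0 \<le> fst p $ x) \<and> (\<forall>x. norm (fst (snd p) $ x) = 1)
      \<and> (\<forall>x i j. (\<Sum>k\<in>UNIV. cnj (snd (snd p) $ x $ k $ i) * snd (snd p) $ x $ k $ j) = (if i = j then 1 else 0))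
      \<and> (\<forall>i j. (\<Sum>x\<in>UNIV. of_real (fst p $ x) * (fst (snd p) $ x $ i * cnj (fst (snd p) $ x $ j)))
          = (if i = j then 1 else 0))}"
    using mem by auto
  show "closed (one_way_params :: ((real ^ 'c) \<times> (complex ^ 'a ^ 'c) \<times> (complex ^ 'b ^ 'b ^ 'c)) set)"
    unfolding eq
    by (intro closed_Collect_conj closed_Collect_all closed_Collect_le closed_Collect_eq continuous_intros)
  have norm_sum: "norm v \<le> (\<Sum>i\<in>UNIV. norm (v $ i))" for v :: "'e :: real_normed_vector ^ 'k"
    unfolding norm_vec_def by (rule L2_set_le_sum) simp
  have "norm p \<le> CARD('a) + (CARD('c) + CARD('c) * (CARD('b) * CARD('b)))"
    if p: "p \<in> one_way_params" for p :: "(real ^ 'c) \<times> (complex ^ 'a ^ 'c) \<times> (complex ^ 'b ^ 'b ^ 'c)"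
  proof -
    obtain t n U where tnU: "p = (t, n, U)" by (cases p)
    have f: "0 \<le> t $ x" "norm (n $ x) = 1" "unitary (U $ x)" for x
      using p by (auto simp: tnU one_way_params_def)
    have "of_real (\<Sum>x\<in>UNIV. t $ x) = trace (\<Sum>x\<in>UNIV. (t $ x) *\<^sub>R ketbra (n $ x))"
      by (simp add: trace_sum trace_scaleR trace_ketbra_1 f)
    also have "\<dots> = of_real (real CARD('a))"
      using p by (simp add: tnU one_way_params_def trace_I)
    finally have sum_t: "(\<Sum>x\<in>UNIV. t $ x) = real CARD('a)" by (simp only: of_real_eq_iff)
    have "norm t \<le> (\<Sum>x\<in>UNIV. t $ x)" using norm_sum[of t] f by simp
    then have t: "norm t \<le> CARD('a)" by (simp add: sum_t)
    have n: "norm n \<le> CARD('c)" using norm_sum[of n] f by simp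
    have "norm (U $ x $ i $ j) \<le> 1" for x i j
      using Finite_Cartesian_Product.norm_nth_le[of "column j (U $ x)" i] unitary_column_norm[OF f(3)]
      by (simp add: column_def)
    then have "norm (U $ x $ i) \<le> CARD('b)" for x i
      using order_trans[OF norm_sum[of "U $ x $ i"] sum_bounded_above[of UNIV _ 1]] by simp
    then have "norm (U $ x) \<le> CARD('b) * CARD('b)" for x
      using order_trans[OF norm_sum[of "U $ x"] sum_bounded_above[of UNIV _ "real CARD('b)"]] by simp
    then have "norm U \<le> CARD('c) * (CARD('b) * CARD('b))"
      using order_trans[OF norm_sum[of U] sum_bounded_above[of UNIV _ "real (CARD('b) * CARD('b))"]] by simp
    moreover have "norm p \<le> norm t + (norm n + norm U)"
      unfolding tnU by (meson add_left_mono norm_Pair_le order_trans)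
    ultimately show ?thesis using t n by simp
  qed
  then show "bounded (one_way_params :: ((real ^ 'c) \<times> (complex ^ 'a ^ 'c) \<times> (complex ^ 'b ^ 'b ^ 'c)) set)"
    unfolding bounded_iff by blast
qed

text \<open>Products of unit vectors never vanish, so by full support both arguments of
  \<open>kl\<close> stay positive on the whole set, whatever the weights.\<close>

lemma continuous_outcome_entropy:
  assumes "pos_full \<rho>" "pos_full \<sigma>"
  shows "continuous_on one_way_params (outcome_entropy \<rho> \<sigma>)"
proof -
  let ?v = "\<lambda>p x y. tens (fst (snd p) $ x) (column y (snd (snd p) $ x))"
  have cont: "continuous_on A (\<lambda>p. qform X (?v p x y))" for A X x y
    unfolding qform_def hinner_def matrix_vector_mult_def tens_def column_def
    by (simp, intro continuous_intros)
  have pos: "0 < qform X (?v p x y)" if "pos_full X" "p \<in> one_way_params" for X p x y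
  proof (rule pos_full_qform_pos[OF that(1)])
    obtain t n U where p: "p = (t, n, U)" by (cases p)
    with that have "norm (n $ x) = 1" "unitary (U $ x)" by (auto simp: one_way_params_def)
    then show "?v p x y \<noteq> 0"
      using unitary_column_nonzero[of "U $ x" y] by (auto simp: p tens_eq_0)
  qed
  have nz: "qform X (?v p x y) \<noteq> 0" if "pos_full X" "p \<in> one_way_params" for X p x y
    using pos[OF that, of x y] by linarith
  have "continuous_on one_way_params (\<lambda>p. \<Sum>x\<in>UNIV. fst p $ x *
      (\<Sum>y\<in>UNIV. kl (qform \<rho> (?v p x y)) (qform \<sigma> (?v p x y))))"
    unfolding kl_def
    by (intro continuous_intros cont) (use nz assms in \<open>simp_all only: divide_eq_0_iff, blast+\<close>)
  then show ?thesis by (simp add: outcome_entropy_def case_prod_unfold)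
qed

lemma sum_inv_into:
  fixes f :: "'k \<Rightarrow> 'c :: finite"
  assumes "inj_on f J" "finite J"
  shows "(\<Sum>c\<in>UNIV. if c \<in> f ` J then G (inv_into J f c) else 0) = (\<Sum>k\<in>J. G k)"
proof -
  have "(\<Sum>c\<in>UNIV. if c \<in> f ` J then G (inv_into J f c) else 0) = (\<Sum>c\<in>f ` J. G (inv_into J f c))"
    by (simp add: sum.If_cases)
  also have "\<dots> = (\<Sum>k\<in>J. G k)"
    by (simp add: sum.reindex[OF assms(1)] assms(1))
  finally show ?thesis .
qed

text \<open>The squared norm of \<open>v k\<close> moves into the weight, which leaves the entropy
  unchanged by homogeneity; missing outcomes are padded with weight 0.\<close>

lemma weighted_vectors_to_params:
  fixes \<rho> \<sigma> :: "complex ^ ('a::finite \<times> 'b::finite) ^ ('a \<times> 'b)" and v :: "'k \<Rightarrow> complex ^ 'a"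
    and B :: "'k \<Rightarrow> complex ^ 'b ^ 'b"
  assumes J: "finite J" "card J \<le> CARD('c)" and s: "\<forall>k\<in>J. 0 \<le> s k" and v: "\<forall>k\<in>J. v k \<noteq> 0"
    and B: "\<forall>k\<in>J. unitary (B k)" and res: "(\<Sum>k\<in>J. s k *\<^sub>R ketbra (v k)) = mat 1"
  shows "\<exists>p \<in> one_way_params :: ((real ^ 'c) \<times> (complex ^ 'a ^ 'c) \<times> (complex ^ 'b ^ 'b ^ 'c)) set.
    outcome_entropy \<rho> \<sigma> p = (\<Sum>k\<in>J. s k *
      (\<Sum>j\<in>UNIV. kl (qform \<rho> (tens (v k) (column j (B k)))) (qform \<sigma> (tens (v k) (column j (B k))))))"
proof -
  obtain f :: "'k \<Rightarrow> 'c" where f: "inj_on f J"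
    using card_le_inj[OF J(1), of "UNIV :: 'c set"] J(2) by auto
  define g where "g = inv_into J f"
  have g: "g c \<in> J" if "c \<in> f ` J" for c using that by (simp add: g_def inv_into_into)
  define t :: "real ^ 'c" where "t = (\<chi> c. if c \<in> f ` J then s (g c) * (norm (v (g c)))\<^sup>2 else 0)"
  \<comment> \<open>At padded positions some unit vector is required;
    \<open>axis undefined 1\<close> is a placeholder whose weight is 0.\<close>
  define n :: "complex ^ 'a ^ 'c" where
    "n = (\<chi> c. if c \<in> f ` J then (1 / norm (v (g c))) *\<^sub>R v (g c) else axis undefined 1)"
  define U :: "complex ^ 'b ^ 'b ^ 'c" where "U = (\<chi> c. if c \<in> f ` J then B (g c) else mat 1)"
  have weighted: "t $ c *\<^sub>R ketbra (n $ c) = (if c \<in> f ` J then s (g c) *\<^sub>R ketbra (v (g c)) else 0)" for c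
    using v g[of c] by (simp add: t_def n_def ketbra_scaleR power_divide)
  have "(\<Sum>c\<in>UNIV. t $ c *\<^sub>R ketbra (n $ c)) = mat 1"
    unfolding weighted unfolding g_def sum_inv_into[OF f J(1), of "\<lambda>k. s k *\<^sub>R ketbra (v k)"] by (rule res)
  moreover have "0 \<le> t $ c \<and> norm (n $ c) = 1 \<and> unitary (U $ c)" for c
    using v s B g[of c] by (auto simp: t_def n_def U_def)
  ultimately have "(t, n, U) \<in> one_way_params"
    by (simp add: one_way_params_def)
  moreover have "outcome_entropy \<rho> \<sigma> (t, n, U) = (\<Sum>k\<in>J. s k *
      (\<Sum>j\<in>UNIV. kl (qform \<rho> (tens (v k) (column j (B k)))) (qform \<sigma> (tens (v k) (column j (B k))))))"
  proof -
    have "t $ c * (\<Sum>j\<in>UNIV. kl (qform \<rho> (tens (n $ c) (column j (U $ c)))) (qform \<sigma> (tens (n $ c) (column j (U $ c)))))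
      = (if c \<in> f ` J then s (g c) * (\<Sum>j\<in>UNIV. kl (qform \<rho> (tens (v (g c)) (column j (B (g c)))))
            (qform \<sigma> (tens (v (g c)) (column j (B (g c)))))) else 0)" for c
    proof (cases "c \<in> f ` J")
      case True
      define r where "r = norm (v (g c))"
      have "r \<noteq> 0" using True g v by (simp add: r_def)
      then have "r\<^sup>2 * (\<Sum>j\<in>UNIV. kl ((1 / r)\<^sup>2 * qform \<rho> (tens (v (g c)) (column j (B (g c)))))
            ((1 / r)\<^sup>2 * qform \<sigma> (tens (v (g c)) (column j (B (g c))))))
          = (\<Sum>j\<in>UNIV. kl (qform \<rho> (tens (v (g c)) (column j (B (g c)))))
            (qform \<sigma> (tens (v (g c)) (column j (B (g c))))))"
        unfolding kl_mult sum_distrib_left[symmetric] by (simp add: power_divide)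
      with True show ?thesis
        by (simp add: t_def n_def U_def tens_scaleR_left qform_scaleR_vec r_def mult.assoc)
    qed (simp add: t_def)
    then show ?thesis
      unfolding outcome_entropy_def prod.case g_def
      by (simp only: sum_inv_into[OF f J(1), of "\<lambda>k. s k * (\<Sum>j\<in>UNIV. kl (qform \<rho> (tens (v k) (column j (B k))))
        (qform \<sigma> (tens (v k) (column j (B k)))))"])
  qed
  ultimately show ?thesis by (rule bexI[rotated])
qed

text \<open>The left-hand side is the entropy of the measurement that reports the pair
  \<open>(x, z)\<close>. Each rank-one part of \<open>QA x\<close> receives its own optimal basis
  \<open>B k\<close> before the weights are touched; with these bases frozen the objective is linear
  in the weights, as the Caratheodory step requires.\<close>

lemma one_way_measurement_bound:
  fixes \<rho> \<sigma> :: "complex ^ ('a::finite \<times> 'b::finite) ^ ('a \<times> 'b)" and QA :: "'x \<Rightarrow> complex ^ 'a ^ 'a"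
    and QB :: "'x \<Rightarrow> 'z \<Rightarrow> complex ^ 'b ^ 'b"
  assumes \<rho>: "pos_full \<rho>" and \<sigma>: "pos_full \<sigma>" and card: "CARD('c) = CARD('a)\<^sup>2"
    and QA: "povm X QA" and QB: "\<forall>x\<in>X. povm Z (QB x)"
  shows "\<exists>p \<in> one_way_params :: ((real ^ 'c) \<times> (complex ^ 'a ^ 'c) \<times> (complex ^ 'b ^ 'b ^ 'c)) set.
    (\<Sum>x\<in>X. \<Sum>z\<in>Z. kl (Re (trace (\<rho> ** (QA x \<otimes>\<^sub>K QB x z)))) (Re (trace (\<sigma> ** (QA x \<otimes>\<^sub>K QB x z)))))
      \<le> outcome_entropy \<rho> \<sigma> p"
proof -
  have finX: "finite X" and psdA: "\<And>x. x \<in> X \<Longrightarrow> psd (QA x)" and sumA: "(\<Sum>x\<in>X. QA x) = mat 1"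
    using QA by (auto simp: povm_def)
  have "\<forall>x\<in>X. \<exists>w :: 'a \<Rightarrow> complex ^ 'a. QA x = (\<Sum>i\<in>UNIV. ketbra (w i))"
    by (intro ballI, rule psd_sum_ketbra[OF psdA]) (assumption, rule exI)
  from bchoice[OF this] obtain w :: "'x \<Rightarrow> 'a \<Rightarrow> complex ^ 'a"
    where w: "\<forall>x\<in>X. QA x = (\<Sum>i\<in>UNIV. ketbra (w x i))"
    by (elim exE)
  \<comment> \<open>Zero vectors are discarded, since only nonzero ones have conditional operators
    of full support; their terms vanish anyway.\<close>
  define I where "I = {k \<in> X \<times> UNIV. w (fst k) (snd k) \<noteq> 0}"
  define v where "v = (\<lambda>k. w (fst k) (snd k))"
  have I: "finite I" "I \<subseteq> X \<times> UNIV" using finX by (auto simp: I_def)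
  define G where "G = (\<lambda>k (B :: complex ^ 'b ^ 'b). \<Sum>j\<in>UNIV. kl (qform \<rho> (tens (v k) (column j B))) (qform \<sigma> (tens (v k) (column j B))))"
  define P where "P = (\<lambda>k z. Re (trace (\<rho> ** (ketbra (v k) \<otimes>\<^sub>K QB (fst k) z))))"
  define Q where "Q = (\<lambda>k z. Re (trace (\<sigma> ** (ketbra (v k) \<otimes>\<^sub>K QB (fst k) z))))"
  have "\<forall>k\<in>I. \<exists>B. unitary B \<and> (\<Sum>z\<in>Z. kl (P k z) (Q k z)) \<le> G k B"
  proof
    fix k assume k: "k \<in> I"
    then have vk: "v k \<noteq> 0" and Zk: "povm Z (QB (fst k))" using QB by (auto simp: I_def v_def)
    obtain U where U: "unitary U" "(\<Sum>z\<in>Z. kl (Re (trace (conditional \<rho> (v k) ** QB (fst k) z)))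
          (Re (trace (conditional \<sigma> (v k) ** QB (fst k) z))))
        \<le> (\<Sum>j\<in>UNIV. kl (qform (conditional \<rho> (v k)) (column j U)) (qform (conditional \<sigma> (v k)) (column j U)))"
      by (rule projective_measurement_optimal[OF pos_full_conditional[OF \<rho> vk]
          pos_full_conditional[OF \<sigma> vk] Zk])
    then have "(\<Sum>z\<in>Z. kl (P k z) (Q k z)) \<le> G k U"
      by (simp only: P_def Q_def G_def trace_conditional qform_conditional)
    with U(1) show "\<exists>B. unitary B \<and> (\<Sum>z\<in>Z. kl (P k z) (Q k z)) \<le> G k B"
      by (intro exI conjI)
  qed
  from bchoice[OF this] obtain B
    where B: "\<forall>k\<in>I. unitary (B k) \<and> (\<Sum>z\<in>Z. kl (P k z) (Q k z)) \<le> G k (B k)"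
    by (elim exE)
  have res: "(\<Sum>k\<in>I. 1 *\<^sub>R ketbra (v k)) = mat 1"
  proof -
    have "(\<Sum>k\<in>I. 1 *\<^sub>R ketbra (v k)) = (\<Sum>k\<in>X \<times> UNIV. ketbra (v k))"
      using finX by (intro sum.mono_neutral_cong_left) (auto simp: I_def v_def)
    also have "\<dots> = (\<Sum>x\<in>X. QA x)"
      by (simp add: w v_def sum.cartesian_product case_prod_unfold)
    finally show ?thesis by (simp add: sumA)
  qed
  have v: "\<And>k. k \<in> I \<Longrightarrow> v k \<noteq> 0" by (simp add: I_def v_def)
  obtain s where s: "\<forall>k\<in>I. 0 \<le> s k" and small: "card {k\<in>I. s k \<noteq> 0} \<le> CARD('a)\<^sup>2"
    and s_res: "(\<Sum>k\<in>I. s k *\<^sub>R ketbra (v k)) = (\<Sum>k\<in>I. 1 *\<^sub>R ketbra (v k))"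
    and s_G: "(\<Sum>k\<in>I. 1 * G k (B k)) \<le> (\<Sum>k\<in>I. s k * G k (B k))"
    by (rule caratheodory_ketbra[OF I(1) v zero_le_one])
  define J where "J = {k\<in>I. s k \<noteq> 0}"
  have "(\<Sum>k\<in>J. s k *\<^sub>R ketbra (v k)) = (\<Sum>k\<in>I. s k *\<^sub>R ketbra (v k))"
    using I(1) by (intro sum.mono_neutral_left) (auto simp: J_def)
  then have J_res: "(\<Sum>k\<in>J. s k *\<^sub>R ketbra (v k)) = mat 1" by (simp only: s_res res)
  have J: "finite J" "J \<subseteq> I" "card J \<le> CARD('c)" using I(1) small by (auto simp: J_def card)
  have sJ: "\<forall>k\<in>J. 0 \<le> s k" and vJ: "\<forall>k\<in>J. v k \<noteq> 0" and BJ: "\<forall>k\<in>J. unitary (B k)"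
    using J(2) s v B by auto
  have "\<exists>p \<in> one_way_params :: ((real ^ 'c) \<times> (complex ^ 'a ^ 'c) \<times> (complex ^ 'b ^ 'b ^ 'c)) set.
      outcome_entropy \<rho> \<sigma> p = (\<Sum>k\<in>J. s k * G k (B k))"
    unfolding G_def by (rule weighted_vectors_to_params[OF J(1,3) sJ vJ BJ J_res])
  then obtain p :: "(real ^ 'c) \<times> (complex ^ 'a ^ 'c) \<times> (complex ^ 'b ^ 'b ^ 'c)"
    where p: "p \<in> one_way_params" "outcome_entropy \<rho> \<sigma> p = (\<Sum>k\<in>J. s k * G k (B k))"
    by (elim bexE)
  have step: "kl (Re (trace (\<rho> ** (QA x \<otimes>\<^sub>K QB x z)))) (Re (trace (\<sigma> ** (QA x \<otimes>\<^sub>K QB x z))))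
      \<le> (\<Sum>i\<in>UNIV. kl (P (x, i) z) (Q (x, i) z))" if "x \<in> X" "z \<in> Z" for x z
  proof -
    have psd: "psd (ketbra (v (x, i)) \<otimes>\<^sub>K QB x z)" for i
      using QB that by (intro psd_kron psd_ketbra) (auto simp: povm_def)
    have tr: "Re (trace (X ** (QA x \<otimes>\<^sub>K QB x z))) = (\<Sum>i\<in>UNIV. Re (trace (X ** (ketbra (v (x, i)) \<otimes>\<^sub>K QB x z))))" for X
      by (simp add: bspec[OF w that(1)] v_def kron_sum_left matrix_sum_right trace_sum)
    show ?thesis
      unfolding tr P_def Q_def fst_conv
    proof (rule log_sum_inequality)
      show "0 \<le> Re (trace (\<rho> ** (ketbra (v (x, i)) \<otimes>\<^sub>K QB x z)))" for i
        using \<rho> psd by (intro Re_trace_nonneg) (simp_all add: pos_full_def)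
      show "0 \<le> Re (trace (\<sigma> ** (ketbra (v (x, i)) \<otimes>\<^sub>K QB x z)))" for i
        using \<sigma> psd by (intro Re_trace_nonneg) (simp_all add: pos_full_def)
      show "Re (trace (\<rho> ** (ketbra (v (x, i)) \<otimes>\<^sub>K QB x z))) = 0"
        if "Re (trace (\<sigma> ** (ketbra (v (x, i)) \<otimes>\<^sub>K QB x z))) = 0" for i
        using trace_zero_pos_full[OF \<sigma> psd that] by simp
    qed
  qed
  have "(\<Sum>x\<in>X. \<Sum>z\<in>Z. kl (Re (trace (\<rho> ** (QA x \<otimes>\<^sub>K QB x z)))) (Re (trace (\<sigma> ** (QA x \<otimes>\<^sub>K QB x z)))))
      \<le> (\<Sum>x\<in>X. \<Sum>z\<in>Z. \<Sum>i\<in>UNIV. kl (P (x, i) z) (Q (x, i) z))"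
    by (intro sum_mono step)
  also have "\<dots> = (\<Sum>x\<in>X. \<Sum>i\<in>UNIV. \<Sum>z\<in>Z. kl (P (x, i) z) (Q (x, i) z))"
    by (intro sum.cong refl sum.swap)
  also have "\<dots> = (\<Sum>k\<in>X \<times> UNIV. \<Sum>z\<in>Z. kl (P k z) (Q k z))"
    by (subst sum.cartesian_product) (simp add: case_prod_unfold)
  also have "\<dots> = (\<Sum>k\<in>I. \<Sum>z\<in>Z. kl (P k z) (Q k z))"
    using finX by (intro sum.mono_neutral_right) (auto simp: I_def P_def v_def)
  also have "\<dots> \<le> (\<Sum>k\<in>I. 1 * G k (B k))"
    using B by (intro sum_mono) simp
  also have "\<dots> \<le> (\<Sum>k\<in>I. s k * G k (B k))" by (rule s_G)
  also have "\<dots> = (\<Sum>k\<in>J. s k * G k (B k))"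
    using I(1) by (intro sum.mono_neutral_right) (auto simp: J_def)
  finally show ?thesis using p by (intro bexI[of _ p]) (simp_all only:)
qed

subsection \<open>Measurements of parameter points\<close>

text \<open>Every row is a multiple of the conjugate of \<open>v\<close>, so the row space is a
  line.\<close>

lemma rank_ketbra:
  assumes "r \<noteq> 0" "v \<noteq> 0"
  shows "rank (r *\<^sub>R ketbra v) = 1"
proof -
  define c :: "complex ^ 'a" where "c = (\<chi> j. cnj (v $ j))"
  have row: "row i (r *\<^sub>R ketbra v) = (of_real r * v $ i) *s c" for i
    by (simp add: row_def ketbra_def c_def vec_eq_iff scaleR_conv_of_real[where 'a = complex] mult.assoc)
  obtain k where k: "v $ k \<noteq> 0" using assms(2) by (auto simp: vec_eq_iff)
  have "c \<noteq> 0" using k by (auto simp: c_def vec_eq_iff)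
  have "vec.span (rows (r *\<^sub>R ketbra v)) = vec.span {c}"
  proof (rule vec.span_eq[THEN iffD2], intro conjI subsetI)
    fix x assume "x \<in> rows (r *\<^sub>R ketbra v)"
    then show "x \<in> vec.span {c}" by (auto simp: rows_def row vec.span_singleton)
  next
    fix x assume "x \<in> {c}"
    then have "x = (1 / (of_real r * v $ k)) *s row k (r *\<^sub>R ketbra v)"
      using k assms(1) by (simp add: row vector_smult_assoc)
    moreover have "row k (r *\<^sub>R ketbra v) \<in> rows (r *\<^sub>R ketbra v)" by (auto simp: rows_def)
    ultimately show "x \<in> vec.span (rows (r *\<^sub>R ketbra v))"
      by (simp add: vec.span_base vec.span_scale)
  qed
  then have "vec.dim (rows (r *\<^sub>R ketbra v)) = vec.dim {c}"
    by (metis vec.dim_span)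
  also have "\<dots> = 1"
    using \<open>c \<noteq> 0\<close> by (simp add: vec.dim_eq_card_independent vec.independent_insert)
  finally show ?thesis by (simp add: row_rank_def_gen)
qed

text \<open>The product operators resolve the identity. Applied to \<rho>, this normalizes the
  optimal \<omega>.\<close>

lemma params_total_weight:
  fixes X :: "complex ^ ('a::finite \<times> 'b::finite) ^ ('a \<times> 'b)" and n :: "complex ^ 'a ^ 'c"
  assumes "(t, n, U) \<in> one_way_params"
  shows "(\<Sum>x\<in>UNIV. \<Sum>y\<in>UNIV. t $ x * qform X (tens (n $ x) (column y (U $ x)))) = Re (trace X)"
proof -
  have U: "unitary (U $ x)" for x using assms by (simp add: one_way_params_def)
  have "(\<Sum>y\<in>UNIV. t $ x * qform X (tens (n $ x) (column y (U $ x))))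
      = Re (trace (X ** ((t $ x *\<^sub>R ketbra (n $ x)) \<otimes>\<^sub>K mat 1)))" for x
  proof -
    have "(\<Sum>y\<in>UNIV. qform X (tens (n $ x) (column y (U $ x))))
        = Re (trace (X ** (ketbra (n $ x) \<otimes>\<^sub>K (\<Sum>y\<in>UNIV. ketbra (column y (U $ x))))))"
      by (simp only: kron_sum_right ketbra_tens Re_trace_sum_ketbra)
    then show ?thesis
      unfolding unitary_resolution[OF U]
      by (simp add: kron_scaleR_left matrix_scaleR_right trace_scaleR flip: sum_distrib_left)
  qed
  then have "(\<Sum>x\<in>UNIV. \<Sum>y\<in>UNIV. t $ x * qform X (tens (n $ x) (column y (U $ x))))
      = Re (trace (X ** ((\<Sum>x\<in>UNIV. t $ x *\<^sub>R ketbra (n $ x)) \<otimes>\<^sub>K mat 1)))"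
    by (simp add: kron_sum_left matrix_sum_right trace_sum)
  with assms show ?thesis by (simp add: one_way_params_def kron_mat_1)
qed

lemma params_to_measurement:
  fixes \<rho> \<sigma> :: "complex ^ ('a::finite \<times> 'b::finite) ^ ('a \<times> 'b)"
    and p :: "(real ^ 'c) \<times> (complex ^ 'a ^ 'c) \<times> (complex ^ 'b ^ 'b ^ 'c)"
  assumes \<rho>: "pos_full \<rho>" and \<sigma>: "pos_full \<sigma>" and p: "p \<in> one_way_params"
  shows "\<exists>(X :: nat set) (Z :: nat set) (QA :: nat \<Rightarrow> complex ^ 'a ^ 'a)
          (QB :: nat \<Rightarrow> nat \<Rightarrow> complex ^ 'b ^ 'b).
         rank1_povm X QA \<and> card X \<le> CARD('c)
         \<and> (\<forall>x\<in>X. projective_measurement Z (QB x))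
         \<and> (Z, one_way X QA QB) \<in> LOCC1
         \<and> rel_entropy Z (outcome_dist \<rho> (one_way X QA QB)) (outcome_dist \<sigma> (one_way X QA QB))
             = ereal (outcome_entropy \<rho> \<sigma> p)"
proof -
  obtain t n U where tnU: "p = (t, n, U)" by (cases p)
  have t: "0 \<le> t $ x" and n: "norm (n $ x) = 1" and U: "unitary (U $ x)" for x
    using p by (auto simp: tnU one_way_params_def)
  have res: "(\<Sum>x\<in>UNIV. t $ x *\<^sub>R ketbra (n $ x)) = mat 1"
    using p by (simp add: tnU one_way_params_def)
  obtain g :: "'c \<Rightarrow> nat" where g: "inj g"
    using finite_imp_inj_to_nat_seg[of "UNIV :: 'c set"] by auto
  obtain e :: "'c \<times> 'b \<Rightarrow> nat" where e: "inj e"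
    using finite_imp_inj_to_nat_seg[of "UNIV :: ('c \<times> 'b) set"] by auto
  \<comment> \<open>Outcomes of weight zero are dropped, as their operators would have rank 0 and
    not 1.\<close>
  define S where "S = {x. t $ x \<noteq> 0}"
  define X where "X = g ` S"
  define Z where "Z = e ` (S \<times> UNIV)"
  define u where "u = (\<lambda>x y. column y (U $ x))"
  define QA where "QA = (\<lambda>k. t $ inv g k *\<^sub>R ketbra (n $ inv g k))"
  \<comment> \<open>A label in \<open>Z\<close> encodes \<open>x\<close> together with the result on
    B, so no information is merged. On labels of another \<open>x'\<close> the operator is 0, which
    gives all conditional measurements the same outcome set.\<close>
  define QB where "QB = (\<lambda>k z. if fst (inv e z) = inv g k then ketbra (u (fst (inv e z)) (snd (inv e z))) else 0)"
  have QA_g: "QA (g x) = t $ x *\<^sub>R ketbra (n $ x)" for x using g by (simp add: QA_def)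
  have QB_e: "QB (g x) (e (x', y)) = (if x' = x then ketbra (u x' y) else 0)" for x x' y
    using g e by (simp add: QB_def)
  have resS: "(\<Sum>x\<in>S. t $ x *\<^sub>R ketbra (n $ x)) = mat 1"
    unfolding res[symmetric] by (intro sum.mono_neutral_left) (auto simp: S_def)
  have povmA: "povm X QA"
    unfolding povm_def X_def using t g resS
    by (auto simp: QA_g psd_scaleR psd_ketbra sum.reindex inj_on_subset)
  have "n $ x \<noteq> 0" for x using n[of x] by auto
  then have rank1: "rank1_povm X QA"
    unfolding rank1_povm_def using povmA by (simp add: X_def S_def QA_g rank_ketbra)
  have resu: "(\<Sum>y\<in>UNIV. ketbra (u x y)) = mat 1" for x
    unfolding u_def by (rule unitary_resolution[OF U])
  have sumZ: "(\<Sum>z\<in>Z. f z) = (\<Sum>x\<in>S. \<Sum>y\<in>UNIV. f (e (x, y)))"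
    for f :: "nat \<Rightarrow> 'v :: comm_monoid_add"
    unfolding Z_def using e by (simp add: sum.reindex inj_on_subset sum.cartesian_product case_prod_unfold)
  have proj: "projective_measurement Z (QB k)" if "k \<in> X" for k
  proof -
    obtain x where x: "x \<in> S" "k = g x" using \<open>k \<in> X\<close> by (auto simp: X_def)
    have "(\<Sum>z\<in>Z. QB k z) = (\<Sum>x'\<in>S. if x' = x then mat 1 else 0)"
      unfolding sumZ x(2) QB_e by (intro sum.cong refl) (simp add: resu)
    also have "\<dots> = mat 1" using x(1) by (simp add: S_def)
    finally have sum: "(\<Sum>z\<in>Z. QB k z) = mat 1" .
    have "ketbra (u x y) ** ketbra (u x y') = (if y = y' then ketbra (u x y) else 0)" for y y'
      using U[of x] by (auto simp: u_def isometry_iff_columns intro: ketbra_mult_self ketbra_mult_orthogonal)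
    then have "QB k z ** QB k z' = (if z = z' then QB k z else 0)" if "z \<in> Z" "z' \<in> Z" for z z'
      using that e unfolding Z_def x(2) by (auto simp: QB_e inj_eq)
    moreover have "\<forall>z\<in>Z. psd (QB k z)"
      by (auto simp: QB_def psd_ketbra psd_0)
    moreover have "finite Z" by (simp add: Z_def)
    ultimately show ?thesis using sum by (simp add: projective_measurement_def povm_def)
  qed
  have ow: "one_way X QA QB (e (x, y)) = t $ x *\<^sub>R ketbra (tens (n $ x) (u x y))" if "x \<in> S" for x y
  proof -
    have "one_way X QA QB (e (x, y)) = (\<Sum>x'\<in>S. QA (g x') \<otimes>\<^sub>K QB (g x') (e (x, y)))"
      unfolding one_way_def X_def using g by (simp add: sum.reindex inj_on_subset)
    also have "\<dots> = (\<Sum>x'\<in>S. if x' = x then t $ x *\<^sub>R ketbra (tens (n $ x) (u x y)) else 0)"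
      unfolding QA_g QB_e by (intro sum.cong refl) (auto simp: kron_scaleR_left ketbra_tens)
    finally show ?thesis using that by (simp add: S_def)
  qed
  have locc: "(Z, one_way X QA QB) \<in> LOCC1"
  proof -
    have "(\<Sum>z\<in>Z. one_way X QA QB z) = (\<Sum>x\<in>S. (t $ x *\<^sub>R ketbra (n $ x)) \<otimes>\<^sub>K (\<Sum>y\<in>UNIV. ketbra (u x y)))"
      unfolding sumZ by (simp add: ow kron_sum_right kron_scaleR_left ketbra_tens)
    also have "\<dots> = mat 1"
      unfolding resu kron_sum_left[symmetric] resS by (rule kron_mat_1)
    finally have "(\<Sum>z\<in>Z. one_way X QA QB z) = mat 1" .
    moreover have "\<forall>z\<in>Z. psd (one_way X QA QB z)"
      unfolding Z_def using t by (auto simp: ow psd_scaleR psd_ketbra)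
    ultimately have "povm Z (one_way X QA QB)" by (simp add: povm_def Z_def)
    with povmA proj show ?thesis
      unfolding LOCC1_def projective_measurement_def by blast
  qed
  have dist: "outcome_dist R (one_way X QA QB) (e (x, y)) = t $ x * qform R (tens (n $ x) (u x y))"
    if "x \<in> S" for R x y
    using that by (simp add: outcome_dist_def ow matrix_scaleR_right trace_scaleR qform_eq_trace)
  have "tens (n $ x) (u x y) \<noteq> 0" for x y
    using n[of x] unitary_column_nonzero[OF U] by (auto simp: tens_eq_0 u_def)
  then have nz: "qform \<sigma> (tens (n $ x) (u x y)) \<noteq> 0" for x y
    using pos_full_qform_pos[OF \<sigma>, of "tens (n $ x) (u x y)"] by auto
  have "rel_entropy Z (outcome_dist \<rho> (one_way X QA QB)) (outcome_dist \<sigma> (one_way X QA QB))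
      = ereal (\<Sum>z\<in>Z. kl (outcome_dist \<rho> (one_way X QA QB) z) (outcome_dist \<sigma> (one_way X QA QB) z))"
    unfolding rel_entropy_def kl_def[symmetric]
    by (subst if_not_P) (auto simp: Z_def dist nz)
  also have "(\<Sum>z\<in>Z. kl (outcome_dist \<rho> (one_way X QA QB) z) (outcome_dist \<sigma> (one_way X QA QB) z))
      = (\<Sum>x\<in>S. t $ x * (\<Sum>y\<in>UNIV. kl (qform \<rho> (tens (n $ x) (u x y))) (qform \<sigma> (tens (n $ x) (u x y)))))"
    unfolding sumZ by (intro sum.cong refl) (simp add: dist kl_mult sum_distrib_left)
  also have "\<dots> = outcome_entropy \<rho> \<sigma> p"
    unfolding outcome_entropy_def tnU prod.case u_def
    by (intro sum.mono_neutral_left) (auto simp: S_def)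
  finally have "rel_entropy Z (outcome_dist \<rho> (one_way X QA QB)) (outcome_dist \<sigma> (one_way X QA QB))
      = ereal (outcome_entropy \<rho> \<sigma> p)" .
  moreover have "card X \<le> CARD('c)"
    unfolding X_def using card_image_le[of S g] card_mono[of UNIV S] by (meson finite order_trans subset_UNIV)
  ultimately show ?thesis using rank1 proj locc by blast
qed

text \<open>The outcome \<open>z\<close> forgets \<open>x\<close>, so its probabilities are sums
  over \<open>x\<close>, and the log-sum inequality shows that forgetting cannot raise the entropy.
  Full support of \<sigma> excludes the infinite case.\<close>

lemma LOCC1_bound:
  fixes \<rho> \<sigma> :: "complex ^ ('a::finite \<times> 'b::finite) ^ ('a \<times> 'b)"
  assumes \<rho>: "pos_full \<rho>" and \<sigma>: "pos_full \<sigma>" and card: "CARD('c) = CARD('a)\<^sup>2"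
    and ZM: "(Z, M) \<in> LOCC1"
  shows "\<exists>p \<in> one_way_params :: ((real ^ 'c) \<times> (complex ^ 'a ^ 'c) \<times> (complex ^ 'b ^ 'b ^ 'c)) set.
    rel_entropy Z (outcome_dist \<rho> M) (outcome_dist \<sigma> M) \<le> ereal (outcome_entropy \<rho> \<sigma> p)"
proof -
  obtain X :: "nat set" and QA :: "nat \<Rightarrow> complex ^ 'a ^ 'a" and QB :: "nat \<Rightarrow> nat \<Rightarrow> complex ^ 'b ^ 'b"
    where povm: "povm Z M" and QA: "povm X QA" and QB: "\<forall>x\<in>X. povm Z (QB x)"
    and M: "\<forall>z\<in>Z. M z = one_way X QA QB z"
    using ZM unfolding LOCC1_def mem_Collect_eq prod.case by (elim exE conjE)
  define P where "P = (\<lambda>x z. Re (trace (\<rho> ** (QA x \<otimes>\<^sub>K QB x z))))"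
  define Q where "Q = (\<lambda>x z. Re (trace (\<sigma> ** (QA x \<otimes>\<^sub>K QB x z))))"
  have psd: "psd (QA x \<otimes>\<^sub>K QB x z)" if "x \<in> X" "z \<in> Z" for x z
    using QA QB that by (intro psd_kron) (auto simp: povm_def)
  have "psd \<rho>" "psd \<sigma>" using \<rho> \<sigma> by (simp_all add: pos_full_def)
  then have PQ: "0 \<le> P x z" "0 \<le> Q x z" "Q x z = 0 \<Longrightarrow> P x z = 0" if "x \<in> X" "z \<in> Z" for x z
    using psd[OF that] Re_trace_nonneg trace_zero_pos_full[OF \<sigma> psd[OF that]] by (auto simp: P_def Q_def)
  have dist: "outcome_dist \<rho> M z = (\<Sum>x\<in>X. P x z)" "outcome_dist \<sigma> M z = (\<Sum>x\<in>X. Q x z)" if "z \<in> Z" for z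
    using M that by (simp_all add: outcome_dist_def P_def Q_def one_way_def matrix_sum_right trace_sum)
  have "outcome_dist \<rho> M z = 0" if "z \<in> Z" "outcome_dist \<sigma> M z = 0" for z
  proof -
    have "psd (M z)" using povm that by (simp add: povm_def)
    from trace_zero_pos_full[OF \<sigma> this] that(2) show ?thesis by (simp add: outcome_dist_def)
  qed
  then have "rel_entropy Z (outcome_dist \<rho> M) (outcome_dist \<sigma> M)
      = ereal (\<Sum>z\<in>Z. kl (outcome_dist \<rho> M z) (outcome_dist \<sigma> M z))"
    by (auto simp: rel_entropy_def kl_def)
  also have "(\<Sum>z\<in>Z. kl (outcome_dist \<rho> M z) (outcome_dist \<sigma> M z)) \<le> (\<Sum>z\<in>Z. \<Sum>x\<in>X. kl (P x z) (Q x z))"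
    using PQ by (intro sum_mono) (simp add: dist log_sum_inequality)
  also have "\<dots> = (\<Sum>x\<in>X. \<Sum>z\<in>Z. kl (P x z) (Q x z))" by (rule sum.swap)
  finally have le: "rel_entropy Z (outcome_dist \<rho> M) (outcome_dist \<sigma> M)
      \<le> ereal (\<Sum>x\<in>X. \<Sum>z\<in>Z. kl (P x z) (Q x z))" by simp
  have "\<exists>p \<in> one_way_params :: ((real ^ 'c) \<times> (complex ^ 'a ^ 'c) \<times> (complex ^ 'b ^ 'b ^ 'c)) set.
    (\<Sum>x\<in>X. \<Sum>z\<in>Z. kl (P x z) (Q x z)) \<le> outcome_entropy \<rho> \<sigma> p"
    unfolding P_def Q_def by (rule one_way_measurement_bound[OF \<rho> \<sigma> card QA QB])
  then obtain p :: "(real ^ 'c) \<times> (complex ^ 'a ^ 'c) \<times> (complex ^ 'b ^ 'b ^ 'c)"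
    where p: "p \<in> one_way_params" "(\<Sum>x\<in>X. \<Sum>z\<in>Z. kl (P x z) (Q x z)) \<le> outcome_entropy \<rho> \<sigma> p"
    by (elim bexE)
  from p(2) have "ereal (\<Sum>x\<in>X. \<Sum>z\<in>Z. kl (P x z) (Q x z)) \<le> ereal (outcome_entropy \<rho> \<sigma> p)" by simp
  with le have "rel_entropy Z (outcome_dist \<rho> M) (outcome_dist \<sigma> M) \<le> ereal (outcome_entropy \<rho> \<sigma> p)"
    by (rule order_trans)
  with p(1) show ?thesis by (intro bexI)
qed

subsection \<open>The variational expression\<close>

lemma pos_full_weighted_sum:
  fixes E :: "'i \<Rightarrow> complex ^ 'n ^ 'n"
  assumes fin: "finite I" and E: "\<And>i. i \<in> I \<Longrightarrow> psd (E i)" and sum: "(\<Sum>i\<in>I. E i) = mat 1"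
    and r: "\<And>i. i \<in> I \<Longrightarrow> 0 < r i"
  shows "pos_full (\<Sum>i\<in>I. r i *\<^sub>R E i)"
proof (rule qform_pos_imp_pos_full)
  show "psd (\<Sum>i\<in>I. r i *\<^sub>R E i)"
    using E r by (intro psd_sum psd_scaleR) (auto intro: less_imp_le)
  fix v :: "complex ^ 'n" assume "v \<noteq> 0"
  have nonneg: "0 \<le> qform (E i) v" if "i \<in> I" for i using E[OF that] by (rule psd_qform_nonneg)
  have q: "qform (\<Sum>i\<in>I. r i *\<^sub>R E i) v = (\<Sum>i\<in>I. r i * qform (E i) v)"
    by (simp add: qform_sum qform_scaleR)
  have "(\<Sum>i\<in>I. r i * qform (E i) v) \<noteq> 0"
  proof
    assume "(\<Sum>i\<in>I. r i * qform (E i) v) = 0"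
    then have "\<forall>i\<in>I. r i * qform (E i) v = 0"
      using fin r nonneg by (subst (asm) sum_nonneg_eq_0_iff) (auto intro!: mult_nonneg_nonneg intro: less_imp_le)
    then have "\<forall>i\<in>I. qform (E i) v = 0" using r by fastforce
    then have "qform (\<Sum>i\<in>I. E i) v = 0" by (simp add: qform_sum)
    with \<open>v \<noteq> 0\<close> show False by (simp add: sum qform_mat_1)
  qed
  moreover have "0 \<le> (\<Sum>i\<in>I. r i * qform (E i) v)"
    using r nonneg by (intro sum_nonneg mult_nonneg_nonneg) (auto intro: less_imp_le)
  ultimately show "0 < qform (\<Sum>i\<in>I. r i *\<^sub>R E i) v" by (simp add: q)
qed

text \<open>The functional calculus is defined by unitary diagonalizations, whereas here the
  \<open>r i\<close> may coincide and the \<open>E i\<close> may have any rank. Comparing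
  \<open>E i ** X = r i *\<^sub>R E i\<close> with a diagonalization gives \<open>r i = l k\<close>
  wherever \<open>E i\<close> does not annihilate the \<open>k\<close>-th eigenvector, so both sides
  agree on an eigenbasis.\<close>

lemma spectral_fun_projections:
  fixes E :: "'i \<Rightarrow> complex ^ 'n ^ 'n"
  assumes fin: "finite I" and herm: "dagger (\<Sum>i\<in>I. r i *\<^sub>R E i) = (\<Sum>i\<in>I. r i *\<^sub>R E i)"
    and sum: "(\<Sum>i\<in>I. E i) = mat 1"
    and proj: "\<And>i j. i \<in> I \<Longrightarrow> j \<in> I \<Longrightarrow> E i ** E j = (if i = j then E i else 0)"
  shows "spectral_fun f (\<Sum>i\<in>I. r i *\<^sub>R E i) = (\<Sum>i\<in>I. f (r i) *\<^sub>R E i)"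
proof -
  let ?X = "\<Sum>i\<in>I. r i *\<^sub>R E i"
  obtain U l where U: "unitary U" and X: "?X = (\<Sum>j\<in>UNIV. l j *\<^sub>R ketbra (column j U))"
    by (rule spectral_theorem[OF herm])
  have EX: "E i ** ?X = r i *\<^sub>R E i" if "i \<in> I" for i
  proof -
    have "E i ** ?X = (\<Sum>j\<in>I. if j = i then r i *\<^sub>R E i else 0)"
      unfolding matrix_sum_right using that
      by (intro sum.cong refl) (auto simp: matrix_scaleR_right proj)
    then show ?thesis using that fin by simp
  qed
  have Xe: "?X *v column k U = l k *\<^sub>R column k U" for k
  proof -
    have "?X *v column k U = (\<Sum>j\<in>UNIV. if j = k then l k *\<^sub>R column k U else 0)"
      unfolding X matrix_sum_vec scaleR_matrix_vec ketbra_vec using U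
      by (intro sum.cong refl) (auto simp: isometry_iff_columns)
    then show ?thesis by simp
  qed
  have eig: "f (r i) *\<^sub>R (E i *v column k U) = f (l k) *\<^sub>R (E i *v column k U)" if "i \<in> I" for i k
  proof -
    have "r i *\<^sub>R (E i *v column k U) = E i *v (?X *v column k U)"
      unfolding matrix_vector_mul_assoc EX[OF that] by (rule scaleR_matrix_vec[symmetric])
    also have "\<dots> = l k *\<^sub>R (E i *v column k U)"
      unfolding Xe by (rule matrix_vec_scaleR)
    finally show ?thesis by (cases "E i *v column k U = 0") simp_all
  qed
  have "(\<Sum>i\<in>I. f (r i) *\<^sub>R E i) = (\<Sum>j\<in>UNIV. f (l j) *\<^sub>R ketbra (column j U))"
  proof -
    have F: "(\<Sum>i\<in>I. f (r i) *\<^sub>R E i) *v column k U = f (l k) *\<^sub>R column k U" for k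
    proof -
      have "(\<Sum>i\<in>I. f (r i) *\<^sub>R E i) *v column k U = (\<Sum>i\<in>I. f (l k) *\<^sub>R (E i *v column k U))"
        unfolding matrix_sum_vec scaleR_matrix_vec by (intro sum.cong refl eig)
      also have "\<dots> = f (l k) *\<^sub>R ((\<Sum>i\<in>I. E i) *v column k U)"
        by (simp only: matrix_sum_vec scaleR_sum_right)
      finally show ?thesis by (simp add: sum)
    qed
    have "(\<Sum>i\<in>I. f (r i) *\<^sub>R E i) ** ketbra (column k U) = f (l k) *\<^sub>R ketbra (column k U)" for k
      unfolding matrix_eq matrix_vector_mul_assoc[symmetric] ketbra_vec matrix_vec_smult F scaleR_matrix_vec
      by (simp add: vec_eq_iff)
    then have "(\<Sum>i\<in>I. f (r i) *\<^sub>R E i) ** (\<Sum>k\<in>UNIV. ketbra (column k U))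
        = (\<Sum>k\<in>UNIV. f (l k) *\<^sub>R ketbra (column k U))"
      unfolding matrix_sum_right by (intro sum.cong refl)
    then show ?thesis unfolding unitary_resolution[OF U] by simp
  qed
  then show ?thesis
    unfolding X sum_ketbra_column by (simp only: spectral_fun_eqI[OF U])
qed

text \<open>By cyclicity, embedding the state amounts to compressing the measurement operator with
  \<open>V\<close>.\<close>

lemma trace_embed:
  "trace (embed_A V R ** (P \<otimes>\<^sub>K B)) = trace (R ** ((dagger V ** P ** V) \<otimes>\<^sub>K B))"
proof -
  let ?W = "V \<otimes>\<^sub>K mat 1"
  have "trace (embed_A V R ** (P \<otimes>\<^sub>K B)) = trace (?W ** (R ** dagger ?W ** (P \<otimes>\<^sub>K B)))"
    by (simp add: embed_A_def matrix_mul_assoc)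
  also have "\<dots> = trace (R ** dagger ?W ** (P \<otimes>\<^sub>K B) ** ?W)"
    by (rule trace_mul_sym)
  also have "\<dots> = trace (R ** (dagger ?W ** (P \<otimes>\<^sub>K B) ** ?W))"
    by (simp add: matrix_mul_assoc)
  also have "dagger ?W ** (P \<otimes>\<^sub>K B) ** ?W = (dagger V ** P ** V) \<otimes>\<^sub>K B"
    by (simp add: dagger_kron kron_mult)
  finally show ?thesis .
qed

text \<open>Shared by both inequalities: on a product resolution of the identity, both terms of the
  objective become sums over the compressed measurement on A and B.\<close>

lemma variational_value:
  fixes R S :: "complex ^ ('a::finite \<times> 'b::finite) ^ ('a \<times> 'b)" and V :: "complex ^ 'a ^ 'c"
    and P :: "'i \<Rightarrow> complex ^ 'c ^ 'c"
  assumes fin: "finite I" and P: "\<And>i. i \<in> I \<Longrightarrow> psd (P i)"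
    and sum: "(\<Sum>i\<in>I. P i \<otimes>\<^sub>K ketbra (u i)) = mat 1"
    and proj: "\<And>i j. i \<in> I \<Longrightarrow> j \<in> I \<Longrightarrow>
      (P i \<otimes>\<^sub>K ketbra (u i)) ** (P j \<otimes>\<^sub>K ketbra (u j)) = (if i = j then P i \<otimes>\<^sub>K ketbra (u i) else 0)"
    and r: "\<And>i. i \<in> I \<Longrightarrow> 0 < r i" and \<omega>: "\<omega> = (\<Sum>i\<in>I. r i *\<^sub>R (P i \<otimes>\<^sub>K ketbra (u i)))"
  shows "pos_full \<omega>"
    and "Re (trace (embed_A V R ** op_log \<omega>))
      = (\<Sum>i\<in>I. ln (r i) * Re (trace (R ** ((dagger V ** P i ** V) \<otimes>\<^sub>K ketbra (u i)))))"
    and "Re (trace (embed_A V S ** \<omega>))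
      = (\<Sum>i\<in>I. r i * Re (trace (S ** ((dagger V ** P i ** V) \<otimes>\<^sub>K ketbra (u i)))))"
proof -
  show pf: "pos_full \<omega>"
    unfolding \<omega> using P by (intro pos_full_weighted_sum fin psd_kron psd_ketbra sum r)
  then have herm: "dagger (\<Sum>i\<in>I. r i *\<^sub>R (P i \<otimes>\<^sub>K ketbra (u i))) = (\<Sum>i\<in>I. r i *\<^sub>R (P i \<otimes>\<^sub>K ketbra (u i)))"
    unfolding \<omega>[symmetric] by (simp add: pos_full_def psd_imp_hermitian)
  have lin: "Re (trace (embed_A V X ** (\<Sum>i\<in>I. s i *\<^sub>R (P i \<otimes>\<^sub>K ketbra (u i)))))
      = (\<Sum>i\<in>I. s i * Re (trace (X ** ((dagger V ** P i ** V) \<otimes>\<^sub>K ketbra (u i)))))" for s X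
    by (simp add: matrix_sum_right matrix_scaleR_right trace_sum trace_scaleR trace_embed)
  have "op_log \<omega> = (\<Sum>i\<in>I. ln (r i) *\<^sub>R (P i \<otimes>\<^sub>K ketbra (u i)))"
    unfolding op_log_def \<omega> by (rule spectral_fun_projections[OF fin herm sum proj])
  then show "Re (trace (embed_A V R ** op_log \<omega>))
      = (\<Sum>i\<in>I. ln (r i) * Re (trace (R ** ((dagger V ** P i ** V) \<otimes>\<^sub>K ketbra (u i)))))"
    by (simp only: lin)
  show "Re (trace (embed_A V S ** \<omega>))
      = (\<Sum>i\<in>I. r i * Re (trace (S ** ((dagger V ** P i ** V) \<otimes>\<^sub>K ketbra (u i)))))"
    unfolding \<omega> by (rule lin)
qed

text \<open>Compressed by \<open>V\<close>, the projections of \<omega> form a measurement of A.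
  Gibbs' inequality with the eigenvalues of \<omega> compares the objective with the entropy of this
  measurement followed by the eigenbases on B.\<close>

lemma variational_bound:
  fixes \<rho> \<sigma> :: "complex ^ ('a::finite \<times> 'b::finite) ^ ('a \<times> 'b)" and V :: "complex ^ 'a ^ 'c"
  assumes card: "CARD('c) = CARD('a)\<^sup>2" and tr: "trace \<rho> = 1"
    and \<rho>: "pos_full \<rho>" and \<sigma>: "pos_full \<sigma>" and V: "dagger V ** V = mat 1"
    and \<omega>: "pos_full \<omega>" "\<omega> \<in> C_star m"
  shows "\<exists>p \<in> one_way_params :: ((real ^ 'c) \<times> (complex ^ 'a ^ 'c) \<times> (complex ^ 'b ^ 'b ^ 'c)) set.
    Re (trace (embed_A V \<rho> ** op_log \<omega>)) - ln (Re (trace (embed_A V \<sigma> ** \<omega>))) \<le> outcome_entropy \<rho> \<sigma> p"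
proof -
  obtain P :: "nat \<Rightarrow> complex ^ 'c ^ 'c" and W :: "nat \<Rightarrow> complex ^ 'b ^ 'b"
    where \<omega>_eq: "\<omega> = (\<Sum>x = 1..m. P x \<otimes>\<^sub>K W x)" and PW: "\<forall>x\<in>{1..m}. \<forall>x'\<in>{1..m}.
       psd (P x) \<and> P x ** P x' = (if x = x' then P x else 0) \<and> psd (W x)"
    using \<omega>(2) unfolding C_star_def mem_Collect_eq by (elim exE conjE)
  define X where "X = {1..m}"
  have fin: "finite X" by (simp add: X_def)
  have P: "psd (P x)" and W: "psd (W x)" if "x \<in> X" for x
    using PW that by (auto simp: X_def)
  have PP: "P x ** P x' = (if x = x' then P x else 0)" if "x \<in> X" "x' \<in> X" for x x'
    using PW that by (simp add: X_def)
  have "\<forall>x\<in>X. \<exists>Ul. unitary (fst Ul) \<and> W x = (\<Sum>j\<in>UNIV. snd Ul j *\<^sub>R ketbra (column j (fst Ul)))"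
  proof
    fix x assume "x \<in> X"
    obtain U l where "unitary U" "W x = (\<Sum>j\<in>UNIV. l j *\<^sub>R ketbra (column j U))"
      by (rule spectral_theorem[OF psd_imp_hermitian[OF W[OF \<open>x \<in> X\<close>]]])
    then show "\<exists>Ul. unitary (fst Ul) \<and> W x = (\<Sum>j\<in>UNIV. snd Ul j *\<^sub>R ketbra (column j (fst Ul)))"
      by (intro exI[of _ "(U, l)"]) simp
  qed
  from bchoice[OF this] obtain Ul :: "nat \<Rightarrow> (complex ^ 'b ^ 'b) \<times> ('b \<Rightarrow> real)" where
    Ul: "\<forall>x\<in>X. unitary (fst (Ul x)) \<and> W x = (\<Sum>j\<in>UNIV. snd (Ul x) j *\<^sub>R ketbra (column j (fst (Ul x))))"
    by (elim exE)
  define u where "u = (\<lambda>x j. column j (fst (Ul x)))"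
  define l where "l = (\<lambda>x. snd (Ul x))"
  have W_eq: "W x = (\<Sum>j\<in>UNIV. l x j *\<^sub>R ketbra (u x j))" if "x \<in> X" for x
    using Ul that by (simp add: u_def l_def)
  have ortho: "hinner (u x i) (u x j) = (if i = j then 1 else 0)" if "x \<in> X" for x i j
    using Ul that unfolding isometry_iff_columns u_def by blast
  have resu: "(\<Sum>j\<in>UNIV. ketbra (u x j)) = mat 1" if "x \<in> X" for x
    unfolding u_def using Ul that by (intro unitary_resolution) blast

  \<comment> \<open>Completeness of the projections comes from full support: \<omega> annihilates
    the range of \<open>R \<otimes>\<^sub>K mat 1\<close> for the defect \<open>R\<close>.\<close>
  have resP: "(\<Sum>x\<in>X. P x) = mat 1"
  proof -
    define R where "R = mat 1 - (\<Sum>x\<in>X. P x)"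
    have PR: "P x ** R = 0" if "x \<in> X" for x
    proof -
      have "P x ** (\<Sum>x'\<in>X. P x') = (\<Sum>x'\<in>X. if x' = x then P x else 0)"
        unfolding matrix_sum_right using that by (intro sum.cong refl) (auto simp: PP)
      then have "P x ** (\<Sum>x'\<in>X. P x') = P x" using that fin by simp
      then show ?thesis
        using matrix_add_ldistrib[of "P x" R "\<Sum>x\<in>X. P x"] by (simp add: R_def)
    qed
    have "\<omega> ** (R \<otimes>\<^sub>K mat 1) = 0"
      unfolding \<omega>_eq X_def[symmetric] matrix_sum_left kron_mult by (simp add: PR)
    then have "\<omega> *v ((R \<otimes>\<^sub>K mat 1) *v v) = 0" for v :: "complex ^ ('c \<times> 'b)"
      by (simp add: matrix_vector_mul_assoc)
    then have "(R \<otimes>\<^sub>K mat 1) *v v = 0" for v :: "complex ^ ('c \<times> 'b)"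
      using \<omega>(1) by (simp add: pos_full_def)
    then have "R \<otimes>\<^sub>K (mat 1 :: complex ^ 'b ^ 'b) = 0" by (simp add: matrix_eq)
    then have "R = 0 \<or> (mat 1 :: complex ^ 'b ^ 'b) = 0" by (simp only: kron_eq_0)
    moreover have "(mat 1 :: complex ^ 'b ^ 'b) \<noteq> 0" by (simp add: mat_def vec_eq_iff)
    ultimately show ?thesis by (simp add: R_def)
  qed

  \<comment> \<open>If \<open>P x = 0\<close>, eigenvalues of \<open>W x\<close> may vanish in spite
    of full support of \<omega>; the value 1 keeps \<open>r\<close> positive and multiplies a zero
    operator.\<close>
  define r where "r = (\<lambda>i. if P (fst i) = 0 then 1 else l (fst i) (snd i))"
  have r: "0 < r i" if i: "i \<in> X \<times> UNIV" for i
  proof (cases "P (fst i) = 0")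
    case False
    obtain x j where ij: "i = (x, j)" "x \<in> X" using i by (cases i) auto
    \<comment> \<open>A vector in the range of \<open>P x\<close>, tensored with an eigenvector of
      \<open>W x\<close>, isolates a single eigenvalue in the form of \<omega>.\<close>
    obtain w where w: "P x *v w \<noteq> 0"
      using False ij by (auto simp: matrix_eq)
    define a where "a = P x *v w"
    have Pa: "P x' *v a = (if x' = x then a else 0)" if "x' \<in> X" for x'
      using PP[OF that ij(2)] by (auto simp: a_def matrix_vector_mul_assoc)
    have "tens a (u x j) \<noteq> 0"
      using w ortho[OF ij(2), of j j] by (auto simp: a_def tens_eq_0)
    then have "0 < qform \<omega> (tens a (u x j))" by (rule pos_full_qform_pos[OF \<omega>(1)])
    also have "qform \<omega> (tens a (u x j)) = (\<Sum>x'\<in>X. if x' = x then (norm a)\<^sup>2 * l x j else 0)"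
      unfolding \<omega>_eq X_def[symmetric] qform_sum
    proof (intro sum.cong refl)
      fix x' assume x': "x' \<in> X"
      have kt: "(P x' \<otimes>\<^sub>K W x') *v tens a (u x j) = tens (P x' *v a) (W x' *v u x j)"
        by (simp add: vec_eq_iff matrix_vector_mult_def kron_nth tens_def mult_ac flip: sum_UNIV_prod)
      have "W x *v u x j = (\<Sum>k\<in>UNIV. if k = j then l x j *\<^sub>R u x j else 0)"
        unfolding W_eq[OF ij(2)] matrix_sum_vec scaleR_matrix_vec ketbra_vec
        by (intro sum.cong refl) (simp add: ortho[OF ij(2)])
      then have "W x *v u x j = l x j *\<^sub>R u x j" by simp
      then show "qform (P x' \<otimes>\<^sub>K W x') (tens a (u x j)) = (if x' = x then (norm a)\<^sup>2 * l x j else 0)"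
        unfolding qform_def kt hinner_tens using Pa[OF x']
        by (simp add: hinner_self[of a] hinner_scaleR_right ortho[OF ij(2)])
    qed
    also have "\<dots> = (norm a)\<^sup>2 * l x j" using fin ij(2) by simp
    finally show ?thesis using False ij(1) by (simp add: r_def zero_less_mult_iff)
  qed (simp add: r_def)
  have "\<omega> = (\<Sum>x\<in>X. \<Sum>j\<in>UNIV. r (x, j) *\<^sub>R (P x \<otimes>\<^sub>K ketbra (u x j)))"
    unfolding \<omega>_eq X_def[symmetric]
  proof (intro sum.cong refl)
    fix x assume "x \<in> X"
    then show "P x \<otimes>\<^sub>K W x = (\<Sum>j\<in>UNIV. r (x, j) *\<^sub>R (P x \<otimes>\<^sub>K ketbra (u x j)))"
      by (cases "P x = 0") (simp_all add: r_def W_eq kron_sum_right kron_scaleR_right)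
  qed
  then have \<omega>_r: "\<omega> = (\<Sum>i\<in>X \<times> UNIV. r i *\<^sub>R (P (fst i) \<otimes>\<^sub>K ketbra (u (fst i) (snd i))))"
    by (simp add: sum.cartesian_product case_prod_unfold)
  have "(\<Sum>x\<in>X. \<Sum>j\<in>UNIV. P x \<otimes>\<^sub>K ketbra (u x j)) = mat 1"
    by (simp add: resu resP kron_mat_1 flip: kron_sum_right kron_sum_left)
  then have sum: "(\<Sum>i\<in>X \<times> UNIV. P (fst i) \<otimes>\<^sub>K ketbra (u (fst i) (snd i))) = mat 1"
    by (simp add: sum.cartesian_product case_prod_unfold)
  have proj: "(P (fst i) \<otimes>\<^sub>K ketbra (u (fst i) (snd i))) ** (P (fst j) \<otimes>\<^sub>K ketbra (u (fst j) (snd j)))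
      = (if i = j then P (fst i) \<otimes>\<^sub>K ketbra (u (fst i) (snd i)) else 0)"
    if "i \<in> X \<times> UNIV" "j \<in> X \<times> UNIV" for i j
    using that unfolding kron_mult
    by (auto simp: PP ortho mem_Times_iff prod_eq_iff ketbra_mult_self ketbra_mult_orthogonal)
  have PX: "psd (P (fst i))" if "i \<in> X \<times> (UNIV :: 'b set)" for i
    using P that by auto
  define p where "p = (\<lambda>i. Re (trace (\<rho> ** ((dagger V ** P (fst i) ** V) \<otimes>\<^sub>K ketbra (u (fst i) (snd i))))))"
  define q where "q = (\<lambda>i. Re (trace (\<sigma> ** ((dagger V ** P (fst i) ** V) \<otimes>\<^sub>K ketbra (u (fst i) (snd i))))))"
  have finI: "finite (X \<times> (UNIV :: 'b set))" using fin by simp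
  note val = variational_value[OF finI PX sum proj r \<omega>_r]
  have vp: "Re (trace (embed_A V \<rho> ** op_log \<omega>)) = (\<Sum>i\<in>X \<times> UNIV. ln (r i) * p i)"
    unfolding p_def by (rule val(2))
  have vq: "Re (trace (embed_A V \<sigma> ** \<omega>)) = (\<Sum>i\<in>X \<times> UNIV. r i * q i)"
    unfolding q_def by (rule val(3))

  define Q where "Q = (\<lambda>x. dagger V ** P x ** V)"
  have povmQ: "povm X Q"
  proof -
    have "(\<Sum>x\<in>X. Q x) = dagger V ** (\<Sum>x\<in>X. P x) ** V"
      by (simp add: Q_def matrix_sum_left matrix_sum_right)
    then show ?thesis using P fin by (simp add: povm_def resP V Q_def psd_conj)
  qed
  have povmu: "\<forall>x\<in>X. povm UNIV (\<lambda>j. ketbra (u x j))"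
    by (simp add: povm_def psd_ketbra resu)
  have psd: "psd (Q (fst i) \<otimes>\<^sub>K ketbra (u (fst i) (snd i)))" if "i \<in> X \<times> UNIV" for i
    using povmQ that by (intro psd_kron psd_ketbra) (auto simp: povm_def)
  have "psd \<rho>" "psd \<sigma>" using \<rho> \<sigma> by (simp_all add: pos_full_def)
  then have p_nonneg: "0 \<le> p i" and q_nonneg: "0 \<le> q i" if "i \<in> X \<times> UNIV" for i
    using Re_trace_nonneg psd[OF that] by (auto simp: p_def q_def Q_def)
  have q0: "p i = 0" if "i \<in> X \<times> UNIV" "q i = 0" for i
    using trace_zero_pos_full[OF \<sigma> psd[OF that(1)]] that(2) by (simp add: p_def q_def Q_def)
  have p1: "(\<Sum>i\<in>X \<times> UNIV. p i) = 1"
  proof -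
    have "(\<Sum>i\<in>X \<times> UNIV. Q (fst i) \<otimes>\<^sub>K ketbra (u (fst i) (snd i)))
        = (\<Sum>x\<in>X. \<Sum>j\<in>UNIV. Q x \<otimes>\<^sub>K ketbra (u x j))"
      by (simp add: sum.cartesian_product case_prod_unfold)
    also have "\<dots> = mat 1"
      using povmQ by (simp add: resu povm_def kron_mat_1 flip: kron_sum_right kron_sum_left)
    finally have "Re (trace (\<rho> ** (\<Sum>i\<in>X \<times> UNIV. Q (fst i) \<otimes>\<^sub>K ketbra (u (fst i) (snd i))))) = 1"
      by (simp add: tr)
    then show ?thesis by (simp add: p_def Q_def matrix_sum_right trace_sum)
  qed
  \<comment> \<open>The trace inside the logarithm. Dividing the eigenvalues by it absorbs the
    second term of the objective and makes both Gibbs corrections sum to 1.\<close>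
  define \<tau> where "\<tau> = (\<Sum>i\<in>X \<times> UNIV. r i * q i)"
  have rq: "0 \<le> r i * q i" if "i \<in> X \<times> UNIV" for i
    by (rule mult_nonneg_nonneg[OF less_imp_le[OF r[OF that]] q_nonneg[OF that]])
  have "\<tau> \<noteq> 0"
  proof
    assume "\<tau> = 0"
    then have 0: "\<forall>i\<in>X \<times> UNIV. r i * q i = 0"
      unfolding \<tau>_def by (subst (asm) sum_nonneg_eq_0_iff[OF finI rq])
    have "p i = 0" if "i \<in> X \<times> UNIV" for i
    proof (rule q0[OF that])
      show "q i = 0" using bspec[OF 0 that] r[OF that] by simp
    qed
    then have "(\<Sum>i\<in>X \<times> UNIV. p i) = 0" by (rule sum.neutral[OF ballI])
    then show False unfolding p1 by (rule zero_neq_one[symmetric, THEN notE])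
  qed
  moreover have "0 \<le> \<tau>"
    unfolding \<tau>_def by (rule sum_nonneg[OF rq])
  ultimately have \<tau>: "0 < \<tau>" by (simp only: less_le simp_thms)
  have "(\<Sum>i\<in>X \<times> UNIV. ln (r i) * p i) - ln \<tau> = (\<Sum>i\<in>X \<times> UNIV. ln (r i) * p i) - ln \<tau> * (\<Sum>i\<in>X \<times> UNIV. p i)"
    by (simp only: p1 mult_1_right)
  also have "\<dots> = (\<Sum>i\<in>X \<times> UNIV. p i * ln (r i / \<tau>))"
    unfolding sum_distrib_left sum_subtractf[symmetric]
  proof (intro sum.cong refl)
    fix i assume "i \<in> X \<times> (UNIV :: 'b set)"
    from r[OF this] \<tau> show "ln (r i) * p i - ln \<tau> * p i = p i * ln (r i / \<tau>)"
      by (simp add: ln_div algebra_simps)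
  qed
  also have "\<dots> \<le> (\<Sum>i\<in>X \<times> UNIV. kl (p i) (q i) + q i * (r i / \<tau>) - p i)"
    using r \<tau> by (intro sum_mono gibbs_term[OF p_nonneg q_nonneg q0] divide_pos_pos)
  also have "\<dots> = (\<Sum>i\<in>X \<times> UNIV. kl (p i) (q i)) + ((\<Sum>i\<in>X \<times> UNIV. r i * q i) / \<tau> - (\<Sum>i\<in>X \<times> UNIV. p i))"
    by (simp add: sum.distrib sum_subtractf sum_divide_distrib mult.commute)
  also have "\<dots> = (\<Sum>i\<in>X \<times> UNIV. kl (p i) (q i))"
    unfolding p1 \<tau>_def[symmetric] using \<tau> by simp
  also have "\<dots> = (\<Sum>x\<in>X. \<Sum>j\<in>UNIV. kl (Re (trace (\<rho> ** (Q x \<otimes>\<^sub>K ketbra (u x j)))))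
      (Re (trace (\<sigma> ** (Q x \<otimes>\<^sub>K ketbra (u x j))))))"
    by (simp add: p_def q_def Q_def sum.cartesian_product case_prod_unfold)
  finally have le: "Re (trace (embed_A V \<rho> ** op_log \<omega>)) - ln (Re (trace (embed_A V \<sigma> ** \<omega>)))
      \<le> (\<Sum>x\<in>X. \<Sum>j\<in>UNIV. kl (Re (trace (\<rho> ** (Q x \<otimes>\<^sub>K ketbra (u x j)))))
      (Re (trace (\<sigma> ** (Q x \<otimes>\<^sub>K ketbra (u x j))))))"
    unfolding vp vq \<tau>_def .
  from one_way_measurement_bound[OF \<rho> \<sigma> card povmQ povmu]
  obtain y :: "(real ^ 'c) \<times> (complex ^ 'a ^ 'c) \<times> (complex ^ 'b ^ 'b ^ 'c)"
    where y: "y \<in> one_way_params" "(\<Sum>x\<in>X. \<Sum>j\<in>UNIV. kl (Re (trace (\<rho> ** (Q x \<otimes>\<^sub>K ketbra (u x j)))))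
      (Re (trace (\<sigma> ** (Q x \<otimes>\<^sub>K ketbra (u x j)))))) \<le> outcome_entropy \<rho> \<sigma> y"
    by (elim bexE)
  show ?thesis by (rule bexI[OF _ y(1)]) (rule order_trans[OF le y(2)])
qed

text \<open>The weights \<open>t\<close> cancel in p / q, so the eigenvalues are formed from the
  unit vectors alone. They are thus positive also at outcomes of weight zero, which is what full
  support of \<omega> demands.\<close>

lemma params_to_variational:
  fixes \<rho> \<sigma> :: "complex ^ ('a::finite \<times> 'b::finite) ^ ('a \<times> 'b)" and V :: "complex ^ 'a ^ 'c"
    and p :: "(real ^ 'c) \<times> (complex ^ 'a ^ 'c) \<times> (complex ^ 'b ^ 'b ^ 'c)"
  assumes card: "CARD('a) \<le> CARD('c)" and tr: "trace \<rho> = 1"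
    and \<rho>: "pos_full \<rho>" and \<sigma>: "pos_full \<sigma>" and V: "dagger V ** V = mat 1"
    and p: "p \<in> one_way_params"
  shows "\<exists>\<omega>. pos_full \<omega> \<and> \<omega> \<in> C_star CARD('c)
    \<and> Re (trace (embed_A V \<rho> ** op_log \<omega>)) - ln (Re (trace (embed_A V \<sigma> ** \<omega>))) = outcome_entropy \<rho> \<sigma> p"
proof -
  obtain t n U where tnU: "p = (t, n, U)" by (cases p)
  have t: "0 \<le> t $ x" and n: "norm (n $ x) = 1" and U: "unitary (U $ x)" for x
    using p by (auto simp: tnU one_way_params_def)
  have res: "(\<Sum>x\<in>UNIV. t $ x *\<^sub>R ketbra (n $ x)) = mat 1"
    using p by (simp add: tnU one_way_params_def)
  define u where "u = (\<lambda>x y. column y (U $ x))"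
  have u: "hinner (u x i) (u x j) = (if i = j then 1 else 0)" for x i j
    using U[of x] by (simp add: u_def isometry_iff_columns)
  have resu: "(\<Sum>y\<in>UNIV. ketbra (u x y)) = mat 1" for x
    unfolding u_def by (rule unitary_resolution[OF U])
  \<comment> \<open>Naimark dilation: \<open>W\<close> sends a vector to its amplitudes along
    \<open>n $ x\<close>, scaled by \<open>sqrt (t $ x)\<close>; being an isometry restates the
    resolution of the identity.\<close>
  define W :: "complex ^ 'a ^ 'c" where "W = (\<chi> x a. of_real (sqrt (t $ x)) * cnj (n $ x $ a))"
  have "dagger W ** W = (\<Sum>x\<in>UNIV. t $ x *\<^sub>R ketbra (n $ x))"
  proof -
    have entry: "of_real (sqrt (t $ x)) * n $ x $ i * (of_real (sqrt (t $ x)) * cnj (n $ x $ j))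
        = of_real (t $ x) * (n $ x $ i * cnj (n $ x $ j))" for x i j
    proof -
      have entry: "of_real (sqrt (t $ x)) * n $ x $ i * (of_real (sqrt (t $ x)) * cnj (n $ x $ j))
          = of_real (sqrt (t $ x) * sqrt (t $ x)) * (n $ x $ i * cnj (n $ x $ j))"
        by (simp only: of_real_mult mult_ac)
      then show ?thesis using t[of x] by simp
    qed
    show ?thesis
      by (simp add: vec_eq_iff W_def dagger_def matrix_matrix_mult_def ketbra_def
          scaleR_conv_of_real[where 'a = complex]) (simp only: entry simp_thms)
  qed
  with res have W: "dagger W ** W = mat 1" by simp
  obtain T :: "complex ^ 'c ^ 'c" where T: "unitary T" "T ** V = W"
    by (rule isometry_unitary_equivalent[OF V W card])
  have T': "unitary (dagger T)" using unitary_right[OF T(1)] by simp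
  \<comment> \<open>As \<open>T ** V = W\<close>, pulling this basis back along \<open>V\<close> is
    pulling the standard basis back along \<open>W\<close>, which yields the vectors
    \<open>sqrt (t $ x) *\<^sub>R n $ x\<close>.\<close>
  define e where "e = (\<lambda>x. column x (dagger T))"
  have e: "hinner (e x) (e y) = (if x = y then 1 else 0)" for x y
    using iffD1[OF isometry_iff_columns T'] by (simp only: e_def)
  have Ve: "dagger V *v e x = sqrt (t $ x) *\<^sub>R n $ x" for x
  proof -
    have "dagger V *v e x = column x (dagger V ** dagger T)"
      by (simp add: e_def column_def vec_eq_iff matrix_vector_mult_def matrix_matrix_mult_def)
    also have "\<dots> = column x (dagger W)" by (simp add: T(2) flip: dagger_mult)
    also have "\<dots> = sqrt (t $ x) *\<^sub>R n $ x"
      by (simp add: column_def dagger_def W_def vec_eq_iff scaleR_conv_of_real[where 'a = complex])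
    finally show ?thesis .
  qed
  define a where "a = (\<lambda>i. qform \<rho> (tens (n $ fst i) (u (fst i) (snd i))))"
  define b where "b = (\<lambda>i. qform \<sigma> (tens (n $ fst i) (u (fst i) (snd i))))"
  have "tens (n $ x) (u x y) \<noteq> 0" for x y
    using n[of x] u[of x y y] by (auto simp: tens_eq_0)
  then have ab: "0 < a i" "0 < b i" for i
    unfolding a_def b_def by (rule pos_full_qform_pos[OF \<rho>], rule pos_full_qform_pos[OF \<sigma>])
  define P where "P = (\<lambda>i :: 'c \<times> 'b. ketbra (e (fst i)))"
  define v where "v = (\<lambda>i. u (fst i) (snd i))"
  define \<omega> where "\<omega> = (\<Sum>i\<in>UNIV. (a i / b i) *\<^sub>R (P i \<otimes>\<^sub>K ketbra (v i)))"
  have VPV: "dagger V ** P i ** V = t $ fst i *\<^sub>R ketbra (n $ fst i)" for i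
    using ketbra_conj[of "dagger V" "e (fst i)"] t by (simp add: P_def Ve ketbra_scaleR)
  have tr_eq: "Re (trace (R ** ((dagger V ** P i ** V) \<otimes>\<^sub>K ketbra (v i))))
      = t $ fst i * qform R (tens (n $ fst i) (u (fst i) (snd i)))" for R i
    by (simp add: VPV v_def kron_scaleR_left ketbra_tens matrix_scaleR_right trace_scaleR qform_eq_trace)
  have sum: "(\<Sum>i\<in>UNIV. P i \<otimes>\<^sub>K ketbra (v i)) = mat 1"
  proof -
    have "(\<Sum>i\<in>UNIV. P i \<otimes>\<^sub>K ketbra (v i)) = (\<Sum>x\<in>UNIV. \<Sum>y\<in>UNIV. ketbra (e x) \<otimes>\<^sub>K ketbra (u x y))"
      by (simp add: P_def v_def sum.cartesian_product case_prod_unfold)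
    also have "\<dots> = (\<Sum>x\<in>UNIV. ketbra (e x)) \<otimes>\<^sub>K mat 1"
      by (simp add: resu flip: kron_sum_right kron_sum_left)
    also have "(\<Sum>x\<in>UNIV. ketbra (e x)) = mat 1"
      unfolding e_def by (rule unitary_resolution[OF T'])
    finally show ?thesis by (simp add: kron_mat_1)
  qed
  have proj: "(P i \<otimes>\<^sub>K ketbra (v i)) ** (P j \<otimes>\<^sub>K ketbra (v j)) = (if i = j then P i \<otimes>\<^sub>K ketbra (v i) else 0)" for i j
    unfolding kron_mult P_def v_def
    by (cases "fst i = fst j") (auto simp: prod_eq_iff e u ketbra_mult_self ketbra_mult_orthogonal)
  have r: "0 < a i / b i" for i using ab by simp
  have PX: "psd (P i)" for i by (simp add: P_def psd_ketbra)
  note val = variational_value[OF finite_class.finite_UNIV PX sum proj r \<omega>_def]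
  have "Re (trace (embed_A V \<rho> ** op_log \<omega>)) = (\<Sum>i\<in>UNIV. ln (a i / b i) * (t $ fst i * a i))"
    unfolding val(2) tr_eq a_def ..
  also have "\<dots> = outcome_entropy \<rho> \<sigma> p"
    unfolding outcome_entropy_def tnU prod.case sum_distrib_left
    by (simp add: sum.cartesian_product case_prod_unfold kl_def a_def b_def u_def mult_ac)
  finally have 1: "Re (trace (embed_A V \<rho> ** op_log \<omega>)) = outcome_entropy \<rho> \<sigma> p" .
  have "Re (trace (embed_A V \<sigma> ** \<omega>)) = (\<Sum>i\<in>UNIV. (a i / b i) * (t $ fst i * b i))"
    unfolding val(3) tr_eq b_def ..
  also have "\<dots> = (\<Sum>i\<in>UNIV. t $ fst i * a i)"
  proof (intro sum.cong refl)
    fix i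
    show "(a i / b i) * (t $ fst i * b i) = t $ fst i * a i"
      using ab(2)[of i] by simp
  qed
  also have "\<dots> = (\<Sum>x\<in>UNIV. \<Sum>y\<in>UNIV. t $ x * qform \<rho> (tens (n $ x) (column y (U $ x))))"
    by (simp add: sum.cartesian_product case_prod_unfold a_def u_def)
  also have "\<dots> = 1"
    using params_total_weight[of t n U \<rho>] p tr by (simp add: tnU)
  finally have 2: "Re (trace (embed_A V \<sigma> ** \<omega>)) = 1" .
  have "\<omega> \<in> C_star CARD('c)"
  proof -
    obtain f :: "nat \<Rightarrow> 'c" where f: "bij_betw f {1..CARD('c)} UNIV"
      using ex_bij_betw_nat_finite_1[of "UNIV :: 'c set"] by auto
    define w where "w = (\<lambda>x. \<Sum>y\<in>UNIV. (a (x, y) / b (x, y)) *\<^sub>R ketbra (u x y))"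
    have "\<omega> = (\<Sum>x\<in>UNIV. ketbra (e x) \<otimes>\<^sub>K w x)"
      by (simp add: \<omega>_def w_def P_def v_def kron_sum_right kron_scaleR_right sum.cartesian_product case_prod_unfold)
    also have "\<dots> = (\<Sum>k = 1..CARD('c). ketbra (e (f k)) \<otimes>\<^sub>K w (f k))"
      using f by (rule sum.reindex_bij_betw[symmetric])
    finally have \<omega>_f: "\<omega> = (\<Sum>k = 1..CARD('c). ketbra (e (f k)) \<otimes>\<^sub>K w (f k))" .
    have psd_w: "psd (w x)" for x
      unfolding w_def by (intro psd_sum psd_scaleR psd_ketbra less_imp_le[OF r])
    have "ketbra (e (f k)) ** ketbra (e (f k')) = (if k = k' then ketbra (e (f k)) else 0)"
      if "k \<in> {1..CARD('c)}" "k' \<in> {1..CARD('c)}" for k k'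
    proof (cases "k = k'")
      case False
      then have "f k \<noteq> f k'" using inj_on_eq_iff[OF bij_betw_imp_inj_on[OF f] that] by simp
      with False show ?thesis by (simp add: e ketbra_mult_orthogonal)
    qed (simp add: e ketbra_mult_self)
    then have "\<forall>k\<in>{1..CARD('c)}. \<forall>k'\<in>{1..CARD('c)}. psd (ketbra (e (f k)))
        \<and> ketbra (e (f k)) ** ketbra (e (f k')) = (if k = k' then ketbra (e (f k)) else 0) \<and> psd (w (f k))"
      by (intro ballI conjI psd_ketbra psd_w)
    with \<omega>_f show ?thesis
      unfolding C_star_def mem_Collect_eq by - (rule exI, rule exI, erule (1) conjI)
  qed
  moreover have "pos_full \<omega>" by (rule val(1))
  ultimately show ?thesis
    by (intro exI[of _ \<omega>] conjI) (simp_all only: 1 2 ln_one diff_zero)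
qed

theorem lemma4:
  fixes \<rho> \<sigma> :: "complex ^ ('a::finite \<times> 'b::finite) ^ ('a \<times> 'b)"
    and \<rho>' \<sigma>' :: "complex ^ ('c::finite \<times> 'b) ^ ('c \<times> 'b)"
    and V :: "complex ^ 'a ^ 'c"
  assumes "CARD('c) = CARD('a) ^ 2"
    and "quantum_state \<rho>" and "pos_full \<rho>" and "pos_full \<sigma>"
    and "isometry V" and "\<rho>' = embed_A V \<rho>" and "\<sigma>' = embed_A V \<sigma>"
  shows "D_LOCC1 \<rho> \<sigma> =
      (SUP \<omega> \<in> {\<omega>. pos_full \<omega> \<and> \<omega> \<in> C_star (CARD('a) ^ 2)}.
         ereal (Re (trace (\<rho>' ** op_log \<omega>)) - ln (Re (trace (\<sigma>' ** \<omega>)))))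
    \<and> (\<exists>(X :: nat set) (Z :: nat set) (QA :: nat \<Rightarrow> complex ^ 'a ^ 'a)
          (QB :: nat \<Rightarrow> nat \<Rightarrow> complex ^ 'b ^ 'b).
         rank1_povm X QA \<and> card X \<le> CARD('a) ^ 2
         \<and> (\<forall>x\<in>X. projective_measurement Z (QB x))
         \<and> (Z, one_way X QA QB) \<in> LOCC1
         \<and> rel_entropy Z (outcome_dist \<rho> (one_way X QA QB)) (outcome_dist \<sigma> (one_way X QA QB))
             = D_LOCC1 \<rho> \<sigma>)"
proof -
  note \<rho> = assms(3) and \<sigma> = assms(4) and card = assms(1)
  have V: "dagger V ** V = mat 1" and tr: "trace \<rho> = 1"
    using assms(2,5) by (simp_all add: isometry_def quantum_state_def)
  have le_card: "CARD('a) \<le> CARD('c)" by (simp add: card power2_eq_square)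
  let ?params = "one_way_params :: ((real ^ 'c) \<times> (complex ^ 'a ^ 'c) \<times> (complex ^ 'b ^ 'b ^ 'c)) set"
  have "?params \<noteq> {}"
  proof -
    \<comment> \<open>The bound applied to the trivial measurement already produces a parameter
      point, that is, a rank-one measurement with few enough outcomes.\<close>
    have "povm {0 :: nat} (\<lambda>_. mat 1 :: complex ^ 'a ^ 'a)" "\<forall>x\<in>{0 :: nat}. povm {0 :: nat} (\<lambda>_. mat 1 :: complex ^ 'b ^ 'b)"
      by (simp_all add: povm_def psd_mat_1)
    from one_way_measurement_bound[OF \<rho> \<sigma> card this]
    obtain p where "p \<in> ?params" by (elim bexE)
    then show ?thesis by (rule ex_in_conv[THEN iffD1, OF exI])
  qed
  from continuous_attains_sup[OF compact_one_way_params this continuous_outcome_entropy[OF \<rho> \<sigma>]]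
  obtain p where p: "p \<in> ?params"
    and max: "\<forall>p'\<in>?params. outcome_entropy \<rho> \<sigma> p' \<le> outcome_entropy \<rho> \<sigma> p"
    by (elim bexE)
  let ?m = "outcome_entropy \<rho> \<sigma> p"
  obtain X Z :: "nat set" and QA :: "nat \<Rightarrow> complex ^ 'a ^ 'a" and QB :: "nat \<Rightarrow> nat \<Rightarrow> complex ^ 'b ^ 'b"
    where opt: "rank1_povm X QA" "card X \<le> CARD('c)" "\<forall>x\<in>X. projective_measurement Z (QB x)"
      "(Z, one_way X QA QB) \<in> LOCC1"
      "rel_entropy Z (outcome_dist \<rho> (one_way X QA QB)) (outcome_dist \<sigma> (one_way X QA QB)) = ereal ?m"
    using params_to_measurement[OF \<rho> \<sigma> p] by (elim exE conjE)
  have D: "D_LOCC1 \<rho> \<sigma> = ereal ?m"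
    unfolding D_LOCC1_def
  proof (rule antisym[OF SUP_least])
    fix ZM assume "ZM \<in> (LOCC1 :: (nat set \<times> (nat \<Rightarrow> complex ^ ('a \<times> 'b) ^ ('a \<times> 'b))) set)"
    then obtain Z' M where ZM: "ZM = (Z', M)" "(Z', M) \<in> LOCC1" by (cases ZM) auto
    from LOCC1_bound[OF \<rho> \<sigma> card ZM(2)] obtain p' where p': "p' \<in> ?params"
      "rel_entropy Z' (outcome_dist \<rho> M) (outcome_dist \<sigma> M) \<le> ereal (outcome_entropy \<rho> \<sigma> p')"
      by (elim bexE)
    from bspec[OF max p'(1)] have "ereal (outcome_entropy \<rho> \<sigma> p') \<le> ereal ?m" by simp
    with p'(2) have "rel_entropy Z' (outcome_dist \<rho> M) (outcome_dist \<sigma> M) \<le> ereal ?m"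
      by (rule order_trans)
    then show "(case ZM of (Z, M) \<Rightarrow> rel_entropy Z (outcome_dist \<rho> M) (outcome_dist \<sigma> M)) \<le> ereal ?m"
      by (simp add: ZM(1))
  next
    show "ereal ?m \<le> (SUP (Z, M)\<in>LOCC1. rel_entropy Z (outcome_dist \<rho> M) (outcome_dist \<sigma> M))"
      by (rule SUP_upper2[OF opt(4)]) (simp add: opt(5))
  qed
  have "(SUP \<omega> \<in> {\<omega>. pos_full \<omega> \<and> \<omega> \<in> C_star (CARD('a) ^ 2)}.
      ereal (Re (trace (\<rho>' ** op_log \<omega>)) - ln (Re (trace (\<sigma>' ** \<omega>))))) = ereal ?m"
    unfolding assms(6,7)
  proof (rule antisym[OF SUP_least])
    fix \<omega> :: "complex ^ ('c \<times> 'b) ^ ('c \<times> 'b)"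
    assume "\<omega> \<in> {\<omega>. pos_full \<omega> \<and> \<omega> \<in> C_star (CARD('a) ^ 2)}"
    then have \<omega>: "pos_full \<omega>" "\<omega> \<in> C_star (CARD('a) ^ 2)" by simp_all
    from variational_bound[OF card tr \<rho> \<sigma> V \<omega>] obtain p' where p': "p' \<in> ?params"
      "Re (trace (embed_A V \<rho> ** op_log \<omega>)) - ln (Re (trace (embed_A V \<sigma> ** \<omega>))) \<le> outcome_entropy \<rho> \<sigma> p'"
      by (elim bexE)
    from order_trans[OF p'(2) bspec[OF max p'(1)]]
    show "ereal (Re (trace (embed_A V \<rho> ** op_log \<omega>)) - ln (Re (trace (embed_A V \<sigma> ** \<omega>)))) \<le> ereal ?m"
      by simp
  next
    from params_to_variational[OF le_card tr \<rho> \<sigma> V p]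
    obtain \<omega> :: "complex ^ ('c \<times> 'b) ^ ('c \<times> 'b)" where \<omega>: "pos_full \<omega>" "\<omega> \<in> C_star CARD('c)"
      "Re (trace (embed_A V \<rho> ** op_log \<omega>)) - ln (Re (trace (embed_A V \<sigma> ** \<omega>))) = ?m"
      by (elim exE conjE)
    have mem: "\<omega> \<in> {\<omega>. pos_full \<omega> \<and> \<omega> \<in> C_star (CARD('a) ^ 2)}"
      using \<omega>(1,2) by (simp add: card)
    show "ereal ?m \<le> (SUP \<omega> \<in> {\<omega>. pos_full \<omega> \<and> \<omega> \<in> C_star (CARD('a) ^ 2)}.
        ereal (Re (trace (embed_A V \<rho> ** op_log \<omega>)) - ln (Re (trace (embed_A V \<sigma> ** \<omega>)))))"
      by (rule SUP_upper2[OF mem]) (simp add: \<omega>(3))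
  qed
  with D opt show ?thesis
    unfolding card by (intro conjI exI[of _ X] exI[of _ Z] exI[of _ QA] exI[of _ QB]) (simp_all only:)
qed

end
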